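(* For every countable universe $\mathcal{U}$, privacy parameters $\varepsilon>0$ and $\delta\in[0,1)$, error probability $\beta\in[0,1)$, and finite range $\mathcal{Y}\subset\mathbb{R}$ with size $k=|\mathcal{Y}|$, there exists a $\lambda$-down-local $(\varepsilon,\delta)$-privacy wrapper $\mathcal{W}$ such that for every function $f:\mathcal{U}^*\to\mathcal{Y}$ and every dataset $x\in\mathcal{U}^*$, with probability at least $1-\beta$, $$\mathcal{W}^f(x)\in\Big[\min f(\mathrm{DN}_\lambda(x)),\ \max f(\mathrm{DN}_\lambda(x))\Big],$$ where $\beta,\delta,\lambda$ satisfy the following: 1. If $\beta>0$, then $\delta=0$ and $\lambda=O\big(\frac1\varepsilon\log\frac{k}{\beta}\big)$; 2. If $\delta>0$, then $\beta=0$ and $\lambda=\frac1\varepsilon\cdot 2^{O(\log^* k)}\log\frac1\delta$ (in this case the wrapper's guarantee holds with probability 1). The constants hidden in the $O(\cdot)$ notation are universal.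
   Context: $\mathcal{U}$ is a countable set (the universe) and $\mathcal{U}^*$ denotes the set of finite subsets of $\mathcal{U}$ (datasets). Two datasets $x,y$ are neighbors if $x=y\cup\{i\}$ or $y=x\cup\{i\}$ for some $i\in\mathcal{U}$. A randomized algorithm $\mathcal{M}$ is $(\varepsilon,\delta)$-differentially private if for all neighbors $x,y$ and all measurable output sets $E$, $\Pr[\mathcal{M}(x)\in E]\le e^\varepsilon\Pr[\mathcal{M}(y)\in E]+\delta$. A privacy wrapper is a randomized algorithm $\mathcal{W}$ that receives a dataset $x\in\mathcal{U}^*$, possibly additional public parameters, and query (black-box) access to a function $f:\mathcal{U}^*\to\mathbb{R}$, and outputs an element of $\mathbb{R}\cup\{\perp\}$; it is an $(\varepsilon,\delta)$-privacy wrapper if for every function $f$ and every choice of the additional parameters, the algorithm $x\mapsto\mathcal{W}^f(x)$ is $(\varepsilon,\delta)$-differentially private. For $\lambda\in\mathbb{N}$, the $\lambda$-down neighborhood of $x$ is $\mathrm{DN}_\lambda(x)=\{z\subseteq x:|x\setminus z|\le\lambda\}$, and for a set $S$ of datasets $f(S)=\{f(z):z\in S\}$. A wrapper is $\lambda$-down local if on input $x$ it queries $f$ only on datasets in $\mathrm{DN}_\lambda(x)$. $\log^*$ denotes the iterated logarithm.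
   Formalization: In case 2 the bound proved is λ ≤ 2^{O(log* k)}·max(1, (1/ε)log(1/δ)), since the literal bound falls below 1 for large ε or δ near 1, where no such wrapper exists; exactly one of β, δ is taken positive; constants are fixed per ambient type of universes (naturals suffice). *)

theory Defs
  imports "HOL-Probability.Probability"
begin

text \<open>
  The datasets over a universe \<open>U\<close> are the members of \<open>Fpow U\<close>, the finite subsets of \<open>U\<close>.
\<close>

definition neighbors :: "'a set \<Rightarrow> 'a set \<Rightarrow> 'a set \<Rightarrow> bool" where
  "neighbors U x y \<longleftrightarrow> (\<exists>i\<in>U. x = y \<union> {i} \<or> y = x \<union> {i})"

definition differentially_private ::
  "'a set \<Rightarrow> 'b measure \<Rightarrow> real \<Rightarrow> real \<Rightarrow> ('a set \<Rightarrow> 'b measure) \<Rightarrow> bool" where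
  "differentially_private U N \<epsilon> \<delta> M \<longleftrightarrow>
     (\<forall>x\<in>Fpow U. M x \<in> space (prob_algebra N)) \<and>
     (\<forall>x\<in>Fpow U. \<forall>y\<in>Fpow U. neighbors U x y \<longrightarrow>
        (\<forall>E\<in>sets N. measure (M x) E \<le> exp \<epsilon> * measure (M y) E + \<delta>))"

definition DN :: "nat \<Rightarrow> 'a set \<Rightarrow> 'a set set" where
  "DN l x = {z. z \<subseteq> x \<and> card (x - z) \<le> l}"

text \<open>
  A deterministic adaptive query algorithm: it either stops with an output, or asks a query and
  continues depending on the answer. Well-foundedness of the datatype means that every run stops
  after finitely many queries.
\<close>

datatype ('q, 'r, 'o) query_alg =
  Output 'o
| Query 'q "'r \<Rightarrow> ('q, 'r, 'o) query_alg"

primrec run :: "('q \<Rightarrow> 'r) \<Rightarrow> ('q, 'r, 'o) query_alg \<Rightarrow> 'o" where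
  "run f (Output r) = r"
| "run f (Query q c) = run f (c (f q))"

primrec queries :: "('q \<Rightarrow> 'r) \<Rightarrow> ('q, 'r, 'o) query_alg \<Rightarrow> 'q set" where
  "queries f (Output r) = {}"
| "queries f (Query q c) = insert q (queries f (c (f q)))"

text \<open>
  A randomized algorithm with black-box access to a function on datasets draws a random seed,
  independently of the dataset and of the function, and then runs the deterministic query algorithm
  determined by the seed and the dataset. A seed in the reals is no restriction on the randomness:
  a uniform real encodes infinitely many independent uniform reals. The output \<open>None\<close> stands for
  the failure symbol.
\<close>

record 'a wrapper =
  seed :: "real measure"
  alg :: "real \<Rightarrow> 'a set \<Rightarrow> ('a set, real, real option) query_alg"

text \<open>The reals together with the failure symbol as an isolated point.\<close>

definition out_space :: "real option measure" where
  "out_space = sigma UNIV {E. Some -` E \<in> sets borel}"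

lemma space_out_space [simp]: "space out_space = UNIV"
  by (simp add: out_space_def space_measure_of_conv)

lemma sets_out_space: "sets out_space = {E. Some -` E \<in> sets borel}"
proof -
  have "sigma_algebra UNIV {E :: real option set. Some -` E \<in> sets borel}"
    by (auto simp: sigma_algebra_iff2 vimage_Diff vimage_UN Compl_eq_Diff_UNIV[symmetric]
        vimage_Compl)
  then show ?thesis
    unfolding out_space_def by (rule sigma_algebra.sets_measure_of_eq)
qed

definition wrapper_output :: "'a wrapper \<Rightarrow> ('a set \<Rightarrow> real) \<Rightarrow> 'a set \<Rightarrow> real option measure" where
  "wrapper_output W f x = distr (seed W) out_space (\<lambda>\<omega>. run f (alg W \<omega> x))"

text \<open>The first three conjuncts say that \<open>W\<close> is a randomized algorithm that queries datasets only.\<close>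

definition privacy_wrapper :: "'a set \<Rightarrow> real \<Rightarrow> real \<Rightarrow> 'a wrapper \<Rightarrow> bool" where
  "privacy_wrapper U \<epsilon> \<delta> W \<longleftrightarrow>
     prob_space (seed W) \<and>
     (\<forall>f. \<forall>x\<in>Fpow U. (\<lambda>\<omega>. run f (alg W \<omega> x)) \<in> seed W \<rightarrow>\<^sub>M out_space) \<and>
     (\<forall>f. \<forall>x\<in>Fpow U. \<forall>\<omega>\<in>space (seed W). queries f (alg W \<omega> x) \<subseteq> Fpow U) \<and>
     (\<forall>f. differentially_private U out_space \<epsilon> \<delta> (wrapper_output W f))"

definition down_local :: "'a set \<Rightarrow> nat \<Rightarrow> 'a wrapper \<Rightarrow> bool" where
  "down_local U l W \<longleftrightarrow>
     (\<forall>f. \<forall>x\<in>Fpow U. \<forall>\<omega>\<in>space (seed W). queries f (alg W \<omega> x) \<subseteq> DN l x)"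

text \<open>
  Iterated binary logarithm: the number of times the logarithm has to be applied to reach a value
  of at most 1.
\<close>

definition log_star :: "nat \<Rightarrow> nat" where
  "log_star k = (LEAST n. (log 2 ^^ n) (real k) \<le> 1)"

end

theory Submission
  imports Defs "HOL-Library.Discrete_Functions"
begin

text \<open>
  For a dataset \<open>x\<close> let \<open>H j\<close> be the minimum, over all ways to remove \<open>j\<close> elements from \<open>x\<close>, of the
  maximum of \<open>f\<close> after removing up to \<open>D - j\<close> further elements. Only \<open>DN D x\<close> is inspected, \<open>H\<close>
  decreases from at most \<open>max f(DN D x)\<close> to at least \<open>min f(DN D x)\<close>, and the sequences of two
  neighbors interleave, \<open>H (j + 1) \<le> H' j\<close> and vice versa. So it suffices to choose privately a point
  of \<open>[H D, H 0]\<close>. With failure probability \<open>\<beta>\<close> the exponential mechanism does this, scoring a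
  point \<open>p\<close> by the number of the nested intervals \<open>[H (D - i), H i]\<close> that contain it.

  Without failures, the logarithms of the lengths of the nested intervals are again an interleaving
  sequence, over a domain of logarithmic size and of about half the length. Recursion yields \<open>r\<close> such
  that an outer interval has at least \<open>2^r\<close> points and an inner one at most \<open>2^(r+1)\<close>. Then the outer
  interval contains a multiple of \<open>2^r\<close> close to the inner one, and at most four multiples of \<open>2^r\<close>
  are close to the inner one, so few layers of intervals suffice to choose among them.
\<close>

section \<open>Approximate domination of mass functions\<close>

text \<open>The slack \<open>e\<close> is the pointwise form of the additive term of differential privacy.\<close>

definition close :: "real \<Rightarrow> real \<Rightarrow> 'a set \<Rightarrow> ('a \<Rightarrow> real) \<Rightarrow> ('a \<Rightarrow> real) \<Rightarrow> bool" where
  "close \<epsilon> \<delta> A P Q \<longleftrightarrow>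
     (\<exists>e. (\<forall>p\<in>A. 0 \<le> e p \<and> P p \<le> exp \<epsilon> * Q p + e p) \<and> sum e A \<le> \<delta>)"

definition pmass :: "'a set \<Rightarrow> ('a \<Rightarrow> real) \<Rightarrow> bool" where
  "pmass A P \<longleftrightarrow> (\<forall>p\<in>A. 0 \<le> P p) \<and> sum P A = 1"

lemma close_mono:
  assumes "close \<epsilon> \<delta> A P Q" "\<epsilon> \<le> \<epsilon>'" "\<delta> \<le> \<delta>'" "\<forall>p\<in>A. 0 \<le> Q p"
  shows "close \<epsilon>' \<delta>' A P Q"
proof -
  obtain e where e: "\<forall>p\<in>A. 0 \<le> e p \<and> P p \<le> exp \<epsilon> * Q p + e p" "sum e A \<le> \<delta>"
    using assms(1) unfolding close_def by blast
  have "P p \<le> exp \<epsilon>' * Q p + e p" if "p \<in> A" for p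
  proof -
    have "exp \<epsilon> * Q p \<le> exp \<epsilon>' * Q p"
      using that assms by (intro mult_right_mono) auto
    then show ?thesis using e(1) that by fastforce
  qed
  then show ?thesis using e assms(3) unfolding close_def by (intro exI[of _ e]) auto
qed

text \<open>The surplus \<open>(exp \<epsilon> - 1) * Q p\<close> moves into the slack, where it
  adds up to \<open>exp \<epsilon> - 1\<close> because \<open>Q\<close> has total mass 1.\<close>

lemma close_absorb:
  assumes "close \<epsilon> \<delta> A P Q" "pmass A Q" "0 \<le> \<epsilon>"
  shows "close 0 (exp \<epsilon> - 1 + \<delta>) A P Q"
proof -
  obtain e where e: "\<forall>p\<in>A. 0 \<le> e p \<and> P p \<le> exp \<epsilon> * Q p + e p" "sum e A \<le> \<delta>"
    using assms(1) unfolding close_def by blast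
  define e' where "e' p = (exp \<epsilon> - 1) * Q p + e p" for p
  have "\<forall>p\<in>A. 0 \<le> e' p \<and> P p \<le> exp 0 * Q p + e' p"
  proof
    fix p assume p: "p \<in> A"
    have "0 \<le> (exp \<epsilon> - 1) * Q p" using p assms(2,3) by (simp add: pmass_def)
    then show "0 \<le> e' p \<and> P p \<le> exp 0 * Q p + e' p"
      using e(1) p by (auto simp: e'_def left_diff_distrib)
  qed
  moreover have "sum e' A \<le> exp \<epsilon> - 1 + \<delta>"
    using e(2) assms(2)
    by (simp add: e'_def sum.distrib sum_distrib_left[symmetric] pmass_def)
  ultimately show ?thesis unfolding close_def by blast
qed

text \<open>
  The second stage need only be private for outcomes \<open>r\<close> that are possible under both \<open>P\<close> and \<open>Q\<close>:
  where \<open>Q r = 0\<close>, the mass \<open>P r\<close> is covered by the slack of the first stage.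
\<close>

lemma close_compose:
  assumes close1: "close \<epsilon>1 \<delta>1 R P Q" and P: "pmass R P" and Q: "\<forall>r\<in>R. 0 \<le> Q r"
    and close2: "\<And>r. r \<in> R \<Longrightarrow> P r \<noteq> 0 \<Longrightarrow> Q r \<noteq> 0 \<Longrightarrow> close \<epsilon>2 \<delta>2 A (K r) (L r)"
    and K: "\<And>r p. r \<in> R \<Longrightarrow> p \<in> A \<Longrightarrow> 0 \<le> K r p" "\<And>r. r \<in> R \<Longrightarrow> sum (K r) A \<le> 1"
    and L: "\<And>r p. r \<in> R \<Longrightarrow> p \<in> A \<Longrightarrow> 0 \<le> L r p"
    and \<delta>2: "0 \<le> \<delta>2"
  shows "close (\<epsilon>1 + \<epsilon>2) (\<delta>1 + \<delta>2) A (\<lambda>p. \<Sum>r\<in>R. P r * K r p) (\<lambda>p. \<Sum>r\<in>R. Q r * L r p)"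
proof -
  obtain e1 where e1: "\<forall>r\<in>R. 0 \<le> e1 r \<and> P r \<le> exp \<epsilon>1 * Q r + e1 r" "sum e1 R \<le> \<delta>1"
    using close1 unfolding close_def by blast
  have "\<exists>e2. \<forall>r\<in>R. P r \<noteq> 0 \<longrightarrow> Q r \<noteq> 0 \<longrightarrow>
      (\<forall>p\<in>A. 0 \<le> e2 r p \<and> K r p \<le> exp \<epsilon>2 * L r p + e2 r p) \<and> sum (e2 r) A \<le> \<delta>2"
    using close2 unfolding close_def by metis
  then obtain e2 where e2: "\<And>r p. r \<in> R \<Longrightarrow> P r \<noteq> 0 \<Longrightarrow> Q r \<noteq> 0 \<Longrightarrow> p \<in> A \<Longrightarrow>
        0 \<le> e2 r p \<and> K r p \<le> exp \<epsilon>2 * L r p + e2 r p"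
      "\<And>r. r \<in> R \<Longrightarrow> P r \<noteq> 0 \<Longrightarrow> Q r \<noteq> 0 \<Longrightarrow> sum (e2 r) A \<le> \<delta>2"
    by blast
  have Pnn: "\<And>r. r \<in> R \<Longrightarrow> 0 \<le> P r" and P1: "sum P R = 1"
    using P by (auto simp: pmass_def)
  \<comment> \<open>Summed over \<open>p\<close> and \<open>r\<close>, the first term contributes at
    most \<open>\<delta>1\<close> because \<open>K r\<close> has mass at most 1, the second at most
    \<open>\<delta>2\<close> because \<open>P\<close> has mass 1.\<close>
  define c where "c r p = e1 r * K r p + (if P r \<noteq> 0 \<and> Q r \<noteq> 0 then P r * e2 r p else 0)" for r p
  have c0: "0 \<le> c r p" if "r \<in> R" "p \<in> A" for r p
    using that e1 e2 K Pnn by (auto simp: c_def)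
  have pt: "P r * K r p \<le> exp (\<epsilon>1 + \<epsilon>2) * (Q r * L r p) + c r p" if r: "r \<in> R" and p: "p \<in> A" for r p
  proof -
    consider "P r = 0" | "Q r = 0" | "P r \<noteq> 0" "Q r \<noteq> 0" by blast
    then show ?thesis
    proof cases
      case 1
      then show ?thesis using c0[OF r p] Q L[OF r p] r by auto
    next
      case 2
      then have "P r \<le> e1 r" using e1 r by auto
      then show ?thesis using 2 K(1)[OF r p] by (auto simp: c_def intro: mult_right_mono)
    next
      case 3
      have b: "0 \<le> e2 r p" "K r p \<le> exp \<epsilon>2 * L r p + e2 r p" using e2(1)[OF r 3 p] by auto
      have a: "0 \<le> e1 r" "P r \<le> exp \<epsilon>1 * Q r + e1 r" using e1 r by auto
      have Pe: "0 \<le> P r * e2 r p" using Pnn[OF r] b by simp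
      show ?thesis
      \<comment> \<open>The order of replacing the two factors depends on this case. If it holds,
        \<open>P r\<close> goes first and \<open>e2\<close> never enters; otherwise
        \<open>K r p\<close> goes first and the leftover
        \<open>e1 r * exp \<epsilon>2 * L r p\<close> is below \<open>e1 r * K r p\<close>. So no
        product of slacks arises and no slack is inflated by an exponential.\<close>
      proof (cases "K r p \<le> exp \<epsilon>2 * L r p")
        case True
        have "P r * K r p \<le> (exp \<epsilon>1 * Q r + e1 r) * K r p"
          using a K(1)[OF r p] by (intro mult_right_mono)
        also have "\<dots> = exp \<epsilon>1 * Q r * K r p + e1 r * K r p" by (simp add: algebra_simps)
        also have "exp \<epsilon>1 * Q r * K r p \<le> exp \<epsilon>1 * Q r * (exp \<epsilon>2 * L r p)"
          using True Q r by (intro mult_left_mono) auto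
        finally show ?thesis using 3 Pe by (simp add: c_def exp_add algebra_simps)
      next
        case False
        have "P r * K r p \<le> P r * (exp \<epsilon>2 * L r p + e2 r p)"
          using b Pnn[OF r] by (intro mult_left_mono)
        also have "\<dots> = P r * (exp \<epsilon>2 * L r p) + P r * e2 r p" by (simp add: algebra_simps)
        also have "P r * (exp \<epsilon>2 * L r p) \<le> (exp \<epsilon>1 * Q r + e1 r) * (exp \<epsilon>2 * L r p)"
          using a L[OF r p] by (intro mult_right_mono) auto
        also have "\<dots> = exp \<epsilon>1 * Q r * (exp \<epsilon>2 * L r p) + e1 r * (exp \<epsilon>2 * L r p)"
          by (simp add: algebra_simps)
        also have "e1 r * (exp \<epsilon>2 * L r p) \<le> e1 r * K r p"
          using False a by (intro mult_left_mono) auto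
        finally show ?thesis using 3 by (simp add: c_def exp_add algebra_simps)
      qed
    qed
  qed
  define e where "e p = (\<Sum>r\<in>R. c r p)" for p
  have "(\<Sum>r\<in>R. P r * K r p) \<le> exp (\<epsilon>1 + \<epsilon>2) * (\<Sum>r\<in>R. Q r * L r p) + e p" if "p \<in> A" for p
    unfolding e_def sum_distrib_left sum.distrib[symmetric] using pt that by (intro sum_mono) auto
  moreover have "0 \<le> e p" if "p \<in> A" for p
    unfolding e_def using c0 that by (intro sum_nonneg) auto
  moreover have "sum e A \<le> \<delta>1 + \<delta>2"
  proof -
    have "sum e A = (\<Sum>r\<in>R. \<Sum>p\<in>A. c r p)"
      unfolding e_def by (rule sum.swap)
    also have "\<dots> \<le> (\<Sum>r\<in>R. e1 r + P r * \<delta>2)"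
    proof (rule sum_mono)
      fix r assume r: "r \<in> R"
      have "e1 r * sum (K r) A \<le> e1 r * 1"
        using K(2)[OF r] e1 r by (intro mult_left_mono) auto
      moreover have "(\<Sum>p\<in>A. if P r \<noteq> 0 \<and> Q r \<noteq> 0 then P r * e2 r p else 0) \<le> P r * \<delta>2"
        using e2(2)[OF r] Pnn[OF r] \<delta>2
        by (cases "P r \<noteq> 0 \<and> Q r \<noteq> 0") (auto simp: sum_distrib_left[symmetric] intro!: mult_left_mono)
      ultimately show "(\<Sum>p\<in>A. c r p) \<le> e1 r + P r * \<delta>2"
        unfolding c_def sum.distrib sum_distrib_left[symmetric] by simp
    qed
    also have "\<dots> = sum e1 R + \<delta>2"
      by (simp add: sum.distrib sum_distrib_right[symmetric] P1)
    finally show ?thesis using e1 by simp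
  qed
  ultimately show ?thesis unfolding close_def by blast
qed

section \<open>Mass functions from nonnegative weights\<close>

definition normalized :: "'a set \<Rightarrow> ('a \<Rightarrow> real) \<Rightarrow> 'a \<Rightarrow> real" where
  "normalized A w p = w p / sum w A"

lemma normalized_nonneg: "\<forall>p\<in>A. 0 \<le> w p \<Longrightarrow> p \<in> A \<Longrightarrow> 0 \<le> normalized A w p"
  by (simp add: normalized_def sum_nonneg)

text \<open>Division by zero yields 0, so weights with total 0 normalize to the zero
  function.\<close>

lemma sum_normalized: "sum (normalized A w) A = (if sum w A = 0 then 0 else 1)"
  by (simp add: normalized_def[abs_def] sum_divide_distrib[symmetric])

text \<open>One factor \<open>exp \<epsilon>\<close> comes from the numerators, the other from the
  ratio of the totals. The additive errors shrink by the factor \<open>z\<close>, a lower bound on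
  both totals.\<close>

lemma close_normalized:
  assumes w: "\<forall>p\<in>A. 0 \<le> w p" "\<forall>p\<in>A. 0 \<le> w' p"
    and e: "\<forall>p\<in>A. 0 \<le> e p \<and> w p \<le> exp \<epsilon> * w' p + e p" "sum e A \<le> b"
    and e': "\<forall>p\<in>A. w' p \<le> exp \<epsilon> * w p + e' p" "sum e' A \<le> b"
    and z: "0 < z" "z \<le> sum w A" "z \<le> sum w' A"
  shows "close (2 * \<epsilon>) ((exp \<epsilon> + 1) * b / z) A (normalized A w) (normalized A w')"
proof -
  define Z Z' where "Z = sum w A" and "Z' = sum w' A"
  have Z: "0 < Z" "0 < Z'" "z \<le> Z" using z by (auto simp: Z_def Z'_def)
  have b: "0 \<le> b" using e by (meson order_trans sum_nonneg)
  have "Z' \<le> (\<Sum>p\<in>A. exp \<epsilon> * w p + e' p)"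
    unfolding Z'_def using e'(1) by (intro sum_mono) auto
  also have "\<dots> \<le> exp \<epsilon> * Z + b"
    using e'(2) by (simp add: sum.distrib sum_distrib_left[symmetric] Z_def)
  finally have ZZ: "Z' / Z \<le> exp \<epsilon> + b / z"
  proof -
    assume "Z' \<le> exp \<epsilon> * Z + b"
    then have "Z' / Z \<le> (exp \<epsilon> * Z + b) / Z" using Z by (intro divide_right_mono) auto
    also have "\<dots> = exp \<epsilon> + b / Z" using Z by (simp add: field_simps)
    also have "\<dots> \<le> exp \<epsilon> + b / z" using Z z b by (intro add_left_mono divide_left_mono) auto
    finally show ?thesis .
  qed
  \<comment> \<open>The first term is the error in the ratio of the totals, the second the error of
    the single weight.\<close>
  define c where "c p = exp \<epsilon> * (b / z) * (w' p / Z') + e p / z" for p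
  have "0 \<le> c p \<and> normalized A w p \<le> exp (2 * \<epsilon>) * normalized A w' p + c p" if p: "p \<in> A" for p
  proof
    show "0 \<le> c p" unfolding c_def using b e w z Z p
      by (intro add_nonneg_nonneg mult_nonneg_nonneg divide_nonneg_nonneg) auto
    have "normalized A w p \<le> (exp \<epsilon> * w' p + e p) / Z"
      unfolding normalized_def Z_def[symmetric] using e p Z by (intro divide_right_mono) auto
    also have "\<dots> = exp \<epsilon> * (w' p / Z') * (Z' / Z) + e p / Z"
      using Z by (simp add: field_simps)
    also have "exp \<epsilon> * (w' p / Z') * (Z' / Z) \<le> exp \<epsilon> * (w' p / Z') * (exp \<epsilon> + b / z)"
      using ZZ w p Z by (intro mult_left_mono) auto
    also have "e p / Z \<le> e p / z"
      using e p Z z by (intro divide_left_mono) auto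
    finally have "normalized A w p \<le> exp \<epsilon> * (w' p / Z') * (exp \<epsilon> + b / z) + e p / z" by simp
    moreover have "exp \<epsilon> * v * (exp \<epsilon> + b / z) = exp (2 * \<epsilon>) * v + exp \<epsilon> * (b / z) * v" for v
    proof -
      have "exp (2 * \<epsilon>) = exp \<epsilon> * exp \<epsilon>" by (metis exp_add mult_2)
      then show ?thesis by (simp only: ring_distribs mult_ac)
    qed
    ultimately show "normalized A w p \<le> exp (2 * \<epsilon>) * normalized A w' p + c p"
      unfolding c_def normalized_def Z'_def[symmetric] by (simp only: add.assoc)
  qed
  moreover have "sum c A \<le> (exp \<epsilon> + 1) * b / z"
  proof -
    have "sum c A = exp \<epsilon> * (b / z) * (sum w' A / Z') + sum e A / z"
      unfolding c_def sum.distrib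
      by (simp add: sum_distrib_left[symmetric] sum_divide_distrib[symmetric])
    also have "\<dots> = exp \<epsilon> * (b / z) + sum e A / z"
      using Z by (simp add: Z'_def)
    also have "\<dots> \<le> exp \<epsilon> * (b / z) + b / z"
      using e(2) z by (intro add_left_mono divide_right_mono) auto
    finally show ?thesis by (simp add: algebra_simps add_divide_distrib)
  qed
  ultimately show ?thesis unfolding close_def by blast
qed

section \<open>Interleaving sequences\<close>

definition seq :: "nat \<Rightarrow> nat \<Rightarrow> (nat \<Rightarrow> nat) \<Rightarrow> bool" where
  "seq V D H \<longleftrightarrow> (\<forall>i j. i \<le> j \<longrightarrow> j \<le> D \<longrightarrow> H j \<le> H i) \<and> H 0 \<le> V"

text \<open>The counterpart for sequences of the neighbor relation. Only indices up to
  \<open>D\<close> are constrained.\<close>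

definition adj :: "nat \<Rightarrow> (nat \<Rightarrow> nat) \<Rightarrow> (nat \<Rightarrow> nat) \<Rightarrow> bool" where
  "adj D H H' \<longleftrightarrow> (\<forall>i<D. H (Suc i) \<le> H' i \<and> H' (Suc i) \<le> H i)"

lemma adj_sym: "adj D H H' \<Longrightarrow> adj D H' H"
  by (auto simp: adj_def)

lemma seq_mono: "seq V D H \<Longrightarrow> i \<le> j \<Longrightarrow> j \<le> D \<Longrightarrow> H j \<le> H i"
  by (auto simp: seq_def)

lemma seq_le: "seq V D H \<Longrightarrow> i \<le> D \<Longrightarrow> H i \<le> V"
  by (meson le0 order_trans seq_def)

lemma adj_hi: "adj D H H' \<Longrightarrow> i < D \<Longrightarrow> H (Suc i) \<le> H' i"
  by (auto simp: adj_def)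

text \<open>Interleaving read from the far end. With \<open>adj_hi\<close> it says that interval
  number \<open>Suc i\<close> of one sequence lies inside interval number \<open>i\<close> of the
  other.\<close>

lemma adj_lo: "adj D H H' \<Longrightarrow> i < D \<Longrightarrow> H' (D - i) \<le> H (D - Suc i)"
  by (metis Suc_diff_Suc adj_def diff_less_Suc not_less_eq)

text \<open>Source of all sensitivity bounds: each counted index except 0 has a counted predecessor
  on the other side, so the counts differ by at most 1.\<close>

lemma card_shift:
  assumes "\<And>j. Suc j < s \<Longrightarrow> A (Suc j) \<Longrightarrow> A' j"
  shows "card {i. i < s \<and> A i} \<le> Suc (card {i. i < s \<and> A' i})"
proof -
  have "{i. i < s \<and> A i} \<subseteq> insert 0 (Suc ` {i. i < s \<and> A' i})"
  proof
    fix i assume "i \<in> {i. i < s \<and> A i}"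
    then show "i \<in> insert 0 (Suc ` {i. i < s \<and> A' i})"
      using assms by (cases i) auto
  qed
  then have "card {i. i < s \<and> A i} \<le> card (insert 0 (Suc ` {i. i < s \<and> A' i}))"
    by (intro card_mono) auto
  also have "\<dots> \<le> Suc (card (Suc ` {i. i < s \<and> A' i}))" by (rule card_insert_le_m1) auto
  also have "\<dots> = Suc (card {i. i < s \<and> A' i})" by (simp add: card_image)
  finally show ?thesis .
qed


section \<open>Private selection among few candidates\<close>

definition shallow :: "nat \<Rightarrow> nat \<Rightarrow> (nat \<Rightarrow> nat) \<Rightarrow> nat \<Rightarrow> nat" where
  "shallow D s H p = card {i. i < s \<and> H (D - i) \<le> p \<and> p \<le> H i}"

lemma shallow_le:
  assumes "adj D H H'" "s \<le> Suc D"
  shows "shallow D s H p \<le> Suc (shallow D s H' p)"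
  unfolding shallow_def
proof (rule card_shift)
  fix j assume "Suc j < s" and p: "H (D - Suc j) \<le> p \<and> p \<le> H (Suc j)"
  then have "j < D" using assms(2) by simp
  then show "H' (D - j) \<le> p \<and> p \<le> H' j"
    using p adj_hi[OF assms(1)] adj_lo[OF assms(1)] by (meson order_trans)
qed

lemma shallow_pos: 
  assumes "seq V D H" "s \<le> Suc D" "shallow D s H p > 0"
  shows "H D \<le> p" "p \<le> H 0"
proof -
  obtain i where i: "i < s" "H (D - i) \<le> p" "p \<le> H i"
    using assms(3) unfolding shallow_def by (auto simp: card_gt_0_iff)
  have "H D \<le> H (D - i)" "H i \<le> H 0"
    using assms(2) i(1) by (auto intro!: seq_mono[OF assms(1)])
  then show "H D \<le> p" "p \<le> H 0" using i by auto
qed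

text \<open>The \<open>t\<close> outermost intervals are skipped and the next \<open>s\<close> are
  widened by \<open>q\<close> on both sides. Adding \<open>q\<close> to the right-hand sides avoids
  truncated subtraction.\<close>

definition deep :: "nat \<Rightarrow> nat \<Rightarrow> nat \<Rightarrow> nat \<Rightarrow> (nat \<Rightarrow> nat) \<Rightarrow> nat \<Rightarrow> nat" where
  "deep D t s q H p = card {i. i < s \<and> H (D - (t + i)) < p + q \<and> p < H (t + i) + q}"

lemma deep_le:
  assumes "adj D H H'" "t + s \<le> D"
  shows "deep D t s q H p \<le> Suc (deep D t s q H' p)"
  unfolding deep_def
proof (rule card_shift)
  fix j assume "Suc j < s" and p: "H (D - (t + Suc j)) < p + q \<and> p < H (t + Suc j) + q"
  then have "t + j < D" using assms(2) by simp
  then have "H' (D - (t + j)) \<le> H (D - (t + Suc j))" "H (t + Suc j) \<le> H' (t + j)"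
    using adj_hi[OF assms(1)] adj_lo[OF assms(1)] by auto
  then show "H' (D - (t + j)) < p + q \<and> p < H' (t + j) + q"
    using p by linarith
qed

lemma deep_pos:
  assumes "seq V D H" "2 * (t + s) \<le> D" "deep D t s q H p > 0"
  shows "H (D - t) < p + q" "p < H t + q"
proof -
  obtain i where i: "i < s" "H (D - (t + i)) < p + q" "p < H (t + i) + q"
    using assms(3) unfolding deep_def by (auto simp: card_gt_0_iff)
  have "H (D - t) \<le> H (D - (t + i))" "H (t + i) \<le> H t"
    using assms(2) i(1) by (auto intro!: seq_mono[OF assms(1)])
  then show "H (D - t) < p + q" "p < H t + q" using i by auto
qed

text \<open>
  The \<open>shallow\<close> part forces a selected point into \<open>[H D, H 0]\<close>; the \<open>deep\<close> part leaves at most four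
  candidates.
\<close>

definition score :: "nat \<Rightarrow> nat \<Rightarrow> nat \<Rightarrow> nat \<Rightarrow> (nat \<Rightarrow> nat) \<Rightarrow> nat \<Rightarrow> nat" where
  "score D t s q H p = (if q dvd p then min (shallow D s H p) (deep D t s q H p) else 0)"

lemma score_le:
  assumes "adj D H H'" "t + s \<le> D"
  shows "score D t s q H p \<le> Suc (score D t s q H' p)"
  using shallow_le[OF assms(1), of s p] deep_le[OF assms, of q p] assms(2)
  by (auto simp: score_def)

text \<open>The points lie strictly between \<open>a - q\<close> and \<open>b + q\<close>, a range
  shorter than \<open>4 * q\<close>.\<close>

lemma card_multiples_le:
  fixes a b q :: nat
  assumes "0 < q" "b - a < 2 * q"
  shows "card {p. q dvd p \<and> a < p + q \<and> p < b + q} \<le> 4"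
proof -
  define c0 where "c0 = a div q"
  have "{p. q dvd p \<and> a < p + q \<and> p < b + q} \<subseteq> (\<lambda>c. q * c) ` {c0..<c0 + 4}"
  proof
    fix p assume p: "p \<in> {p. q dvd p \<and> a < p + q \<and> p < b + q}"
    then obtain c where c: "p = q * c" by (auto elim: dvdE)
    have a: "q * c0 \<le> a" "a < q * Suc c0"
      using assms(1) dividend_less_times_div[of q a] by (auto simp: c0_def)
    have "a < q * Suc c" using p c by (simp add: algebra_simps)
    then have "q * c0 < q * Suc c" using a by linarith
    then have "c0 \<le> c" by (simp only: mult_less_cancel1) simp
    moreover have "q * c < q * (c0 + 4)"
    proof -
      have "b < a + 2 * q" "q * c < b + q" using p c assms by auto
      then have "q * c < q * Suc c0 + 3 * q" using a(2) by linarith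
      then show ?thesis by (simp add: algebra_simps)
    qed
    then have "c < c0 + 4" by (simp only: mult_less_cancel1)
    ultimately show "p \<in> (\<lambda>c. q * c) ` {c0..<c0 + 4}" using c by auto
  qed
  then have "card {p. q dvd p \<and> a < p + q \<and> p < b + q} \<le> card ((\<lambda>c. q * c) ` {c0..<c0 + 4})"
    by (intro card_mono) auto
  also have "\<dots> \<le> card {c0..<c0 + 4}" by (rule card_image_le) simp
  finally show ?thesis by simp
qed

lemma card_score_pos_le:
  assumes "seq V D H" "2 * (t + s) \<le> D" "0 < q" "H t - H (D - t) < 2 * q"
  shows "card {p\<in>{..V}. score D t s q H p > 0} \<le> 4"
proof -
  have "{p\<in>{..V}. score D t s q H p > 0} \<subseteq> {p. q dvd p \<and> H (D - t) < p + q \<and> p < H t + q}"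
    using deep_pos[OF assms(1,2)] by (auto simp: score_def split: if_splits)
  moreover have "finite {p. q dvd p \<and> H (D - t) < p + q \<and> p < H t + q}"
    by (rule finite_subset[of _ "{..<H t + q}"]) auto
  ultimately show ?thesis
    using card_multiples_le[OF assms(3,4)] by (meson card_mono order_trans)
qed

text \<open>Round \<open>z\<close> down to a multiple of \<open>q\<close>. If this falls below
  \<open>a\<close>, the next multiple is still at most \<open>b\<close>, because the interval
  contains at least \<open>q\<close> points.\<close>

lemma multiple_near:
  fixes a b z q :: nat
  assumes "0 < q" "a \<le> z" "z \<le> b" "q \<le> b - a + 1"
  obtains p where "q dvd p" "a \<le> p" "p \<le> b" "z < p + q" "p < z + q"
proof -
  define p1 where "p1 = q * (z div q)"
  have p1: "p1 \<le> z" "z < p1 + q" "q dvd p1"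
    using assms(1) dividend_less_times_div[of q z] by (auto simp: p1_def)
  show thesis
  proof (cases "a \<le> p1")
    case True
    then show thesis using that[of p1] p1 assms by auto
  next
    case False
    then show thesis using that[of "p1 + q"] p1 assms by auto
  qed
qed

lemma score_full:
  assumes "seq V D H" "2 * (t + s) \<le> D" "s \<le> t" "0 < q" "q \<le> H s - H (D - s) + 1"
  obtains p where "p \<le> V" "score D t s q H p = s"
proof -
  note mono = seq_mono[OF assms(1)]
  \<comment> \<open>This value lies in every interval of index at most \<open>t + s\<close>. A
    multiple within distance \<open>q\<close> of it is therefore counted by all deep intervals, and
    if it also lies in interval number \<open>s\<close>, by all shallow ones.\<close>
  define z where "z = H (t + s)"
  have "H (D - s) \<le> z" "z \<le> H s" using assms(2,3) by (auto simp: z_def intro!: mono)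
  then obtain p where p: "q dvd p" "H (D - s) \<le> p" "p \<le> H s" "z < p + q" "p < z + q"
    using multiple_near[OF assms(4) _ _ assms(5)] by blast
  have "{i. i < s \<and> H (D - i) \<le> p \<and> p \<le> H i} = {..<s}"
  proof -
    have "H (D - i) \<le> p \<and> p \<le> H i" if "i < s" for i
    proof -
      have "H (D - i) \<le> H (D - s)" "H s \<le> H i"
        using that assms(2) by (auto intro!: mono)
      then show ?thesis using p by auto
    qed
    then show ?thesis by auto
  qed
  then have "shallow D s H p = s" by (simp add: shallow_def)
  moreover have "{i. i < s \<and> H (D - (t + i)) < p + q \<and> p < H (t + i) + q} = {..<s}"
  proof -
    have "H (D - (t + i)) < p + q \<and> p < H (t + i) + q" if "i < s" for i
    proof -
      have "H (D - (t + i)) \<le> z" "z \<le> H (t + i)"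
        using that assms(2) by (auto simp: z_def intro!: mono)
      then show ?thesis using p by auto
    qed
    then show ?thesis by auto
  qed
  then have "deep D t s q H p = s" by (simp add: deep_def)
  ultimately have "score D t s q H p = s" using p by (simp add: score_def)
  moreover have "p \<le> V" using p(3) seq_le[OF assms(1), of s] assms(2) by auto
  ultimately show thesis using that by blast
qed

text \<open>
  Exponential weights, shifted so that score 0 gets weight 0 and is never selected; the price is
  an additive error of 1 for each candidate.
\<close>

definition weight :: "real \<Rightarrow> nat \<Rightarrow> real" where
  "weight \<epsilon> u = (\<Sum>i<u. exp \<epsilon> ^ i)"

lemma weight_nonneg: "0 \<le> weight \<epsilon> u"
  by (simp add: weight_def sum_nonneg)

lemma weight_0 [simp]: "weight \<epsilon> 0 = 0"
  by (simp add: weight_def)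

lemma weight_Suc: "weight \<epsilon> (Suc u) = exp \<epsilon> * weight \<epsilon> u + 1"
  by (simp add: weight_def sum.lessThan_Suc_shift sum_distrib_left del: sum.lessThan_Suc)

lemma weight_mono: "u \<le> v \<Longrightarrow> weight \<epsilon> u \<le> weight \<epsilon> v"
  unfolding weight_def by (intro sum_mono2) auto

lemma weight_le: "u \<le> Suc v \<Longrightarrow> weight \<epsilon> u \<le> exp \<epsilon> * weight \<epsilon> v + (if u > 0 then 1 else 0)"
  using weight_mono[of u "Suc v" \<epsilon>] weight_nonneg[of \<epsilon> v] by (auto simp: weight_Suc)

text \<open>These are the two largest terms of the sum. The factor \<open>exp \<epsilon> + 1\<close>
  is there to cancel the one from \<open>close_normalized\<close>.\<close>

lemma weight_ge: "(exp \<epsilon> + 1) * exp \<epsilon> ^ n \<le> weight \<epsilon> (n + 2)"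
  using weight_nonneg[of \<epsilon> n] by (simp add: weight_def algebra_simps)

definition select :: "real \<Rightarrow> nat \<Rightarrow> nat \<Rightarrow> nat \<Rightarrow> nat \<Rightarrow> nat \<Rightarrow> (nat \<Rightarrow> nat) \<Rightarrow> nat \<Rightarrow> real" where
  "select \<epsilon> V D t s q H = normalized {..V} (\<lambda>p. weight \<epsilon> (score D t s q H p))"

lemma select_nonneg: "p \<le> V \<Longrightarrow> 0 \<le> select \<epsilon> V D t s q H p"
  unfolding select_def by (rule normalized_nonneg) (auto simp: weight_nonneg)

lemma sum_select_le: "sum (select \<epsilon> V D t s q H) {..V} \<le> 1"
  by (simp add: select_def sum_normalized)

lemma select_range:
  assumes "seq V D H" "s \<le> D" "select \<epsilon> V D t s q H p \<noteq> 0"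
  shows "H D \<le> p" "p \<le> H 0"
proof -
  have *: "shallow D s H p > 0"
    using assms(3) by (auto simp: select_def normalized_def score_def split: if_splits intro!: gr0I)
  then show "H D \<le> p" "p \<le> H 0"
    using shallow_pos[OF assms(1) _ *] assms(2) by auto
qed

lemma sum_weight_ge:
  assumes "seq V D H" "2 * (t + s) \<le> D" "s \<le> t" "0 < q" "q \<le> H s - H (D - s) + 1"
  shows "weight \<epsilon> s \<le> (\<Sum>p\<le>V. weight \<epsilon> (score D t s q H p))"
proof -
  obtain p where "p \<le> V" "score D t s q H p = s" using score_full[OF assms] by blast
  then show ?thesis
    using member_le_sum[of p "{..V}" "\<lambda>p. weight \<epsilon> (score D t s q H p)"] weight_nonneg by auto
qed

lemma sum_select:
  assumes "seq V D H" "2 * (t + s) \<le> D" "s \<le> t" "0 < q" "q \<le> H s - H (D - s) + 1" "0 < s"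
  shows "sum (select \<epsilon> V D t s q H) {..V} = 1"
proof -
  have "0 < weight \<epsilon> s"
    using assms(6) weight_mono[of 1 s \<epsilon>] by (simp add: weight_def)
  then show ?thesis
    using sum_weight_ge[OF assms(1-5), of \<epsilon>] by (auto simp: select_def sum_normalized)
qed

text \<open>Some multiple attains the full score, so both totals are at least
  \<open>weight \<epsilon> s\<close>; at most four points have positive score, so the additive
  errors sum to at most 4. The same \<open>q\<close> has to fit both sequences.\<close>

lemma close_select:
  assumes H: "seq V D H" "q \<le> H s - H (D - s) + 1" "H t - H (D - t) < 2 * q"
    and H': "seq V D H'" "q \<le> H' s - H' (D - s) + 1" "H' t - H' (D - t) < 2 * q"
    and adj: "adj D H H'" and s: "2 * (t + s) \<le> D" "s \<le> t" "s = n + 2" and q: "0 < q"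
  shows "close (2 * \<epsilon>) (4 / exp \<epsilon> ^ n) {..V} (select \<epsilon> V D t s q H) (select \<epsilon> V D t s q H')"
proof -
  define u u' where "u = score D t s q H" and "u' = score D t s q H'"
  define e where "e v p = (if v p > 0 then 1 else 0 :: real)" for v :: "nat \<Rightarrow> nat" and p
  have e: "sum (e u) {..V} \<le> 4" "sum (e u') {..V} \<le> 4"
    using card_score_pos_le[OF H(1) s(1) q H(3)] card_score_pos_le[OF H'(1) s(1) q H'(3)]
    by (simp_all add: e_def u_def u'_def sum.If_cases Int_def)
  have z: "0 < weight \<epsilon> s"
    using s(3) weight_mono[of 1 s \<epsilon>] by (simp add: weight_def)
  have uu: "u p \<le> Suc (u' p)" "u' p \<le> Suc (u p)" for p
    using score_le[OF adj] score_le[OF adj_sym[OF adj]] s by (auto simp: u_def u'_def)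
  have "close (2 * \<epsilon>) ((exp \<epsilon> + 1) * 4 / weight \<epsilon> s) {..V} (select \<epsilon> V D t s q H) (select \<epsilon> V D t s q H')"
    unfolding select_def u_def[symmetric] u'_def[symmetric]
  proof (rule close_normalized[OF _ _ _ e(1) _ e(2) z])
    show "weight \<epsilon> s \<le> (\<Sum>p\<le>V. weight \<epsilon> (u p))" "weight \<epsilon> s \<le> (\<Sum>p\<le>V. weight \<epsilon> (u' p))"
      unfolding u_def u'_def using sum_weight_ge H H' s q by auto
  qed (use uu in \<open>auto simp: weight_nonneg e_def intro!: weight_le[THEN order_trans]\<close>)
  moreover have "(exp \<epsilon> + 1) * 4 / weight \<epsilon> s \<le> 4 / exp \<epsilon> ^ n"
  proof -
    have "(exp \<epsilon> + 1) * 4 / weight \<epsilon> s \<le> (exp \<epsilon> + 1) * 4 / ((exp \<epsilon> + 1) * exp \<epsilon> ^ n)"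
      using weight_ge[of \<epsilon> n] s(3) z
      by (intro divide_left_mono) (auto intro!: mult_pos_pos add_pos_pos)
    also have "\<dots> = 4 / exp \<epsilon> ^ n"
    proof -
      have "(e + 1) * 4 / ((e + 1) * x) = 4 / x" if "0 < e" for e x :: real
        by (rule nonzero_mult_divide_mult_cancel_left) (use that in simp)
      then show ?thesis by simp
    qed
    finally show ?thesis .
  qed
  ultimately show ?thesis
    by (rule close_mono[OF _ order_refl]) (auto intro: select_nonneg)
qed


section \<open>The recursive mechanism\<close>

text \<open>The offset \<open>s\<close> leaves the outermost intervals to the shallow score. Lengths
  0 and 1 both have logarithm 0.\<close>

definition width :: "nat \<Rightarrow> nat \<Rightarrow> (nat \<Rightarrow> nat) \<Rightarrow> nat \<Rightarrow> nat" where
  "width D s H i = floor_log (H (s + i) - H (D - (s + i)))"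

lemma seq_width:
  assumes "seq V D H" "s + D' \<le> D"
  shows "seq (floor_log V) D' (width D s H)"
proof -
  have "width D s H j \<le> width D s H i" if "i \<le> j" "j \<le> D'" for i j
  proof -
    have "H (s + j) \<le> H (s + i)" "H (D - (s + i)) \<le> H (D - (s + j))"
      using that assms(2) by (auto intro!: seq_mono[OF assms(1)])
    then show ?thesis unfolding width_def by (intro floor_log_le_iff) auto
  qed
  moreover have "width D s H 0 \<le> floor_log V"
    using seq_le[OF assms(1), of s] assms(2) unfolding width_def by (intro floor_log_le_iff) auto
  ultimately show ?thesis by (auto simp: seq_def)
qed

text \<open>Nested intervals have ordered lengths, so interleaving passes to the logarithms and the
  recursion faces the same kind of problem.\<close>

lemma adj_width:
  assumes "adj D H H'" "s + D' \<le> D"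
  shows "adj D' (width D s H) (width D s H')"
proof -
  have "width D s H (Suc i) \<le> width D s H' i" if "i < D'" "adj D H H'" for i H H'
  proof -
    have "H (s + Suc i) \<le> H' (s + i)" "H' (D - (s + i)) \<le> H (D - (s + Suc i))"
      using adj_hi[OF that(2), of "s + i"] adj_lo[OF that(2), of "s + i"] that(1) assms(2) by auto
    then show ?thesis unfolding width_def by (intro floor_log_le_iff) auto
  qed
  then show ?thesis using assms(1) adj_sym[OF assms(1)] by (auto simp: adj_def[of D'])
qed

text \<open>Counting points, hence \<open>n + 1\<close>, makes the bound hold for
  \<open>n = 0\<close>, where \<open>floor_log\<close> is 0.\<close>

lemma power_le_width:
  assumes "r \<le> floor_log n"
  shows "2 ^ r \<le> n + 1"
proof (cases "n = 0")
  case False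
  then have "2 ^ floor_log n \<le> n" by (intro floor_log_exp2_le) auto
  moreover have "2 ^ r \<le> (2 :: nat) ^ floor_log n" using assms by (intro power_increasing) auto
  ultimately show ?thesis by linarith
qed (use assms in auto)

lemma width_less_power:
  assumes "floor_log n \<le> r"
  shows "n < 2 * 2 ^ r"
proof -
  have "2 ^ floor_log n \<le> (2 :: nat) ^ r" using assms by (intro power_increasing) auto
  then show ?thesis using floor_log_exp2_gt[of n] by linarith
qed

text \<open>The values are 0, 1, 2, 4, 16 and so on. Starting at 0 makes the recursion end when a
  single point is left.\<close>

fun tower :: "nat \<Rightarrow> nat" where
  "tower 0 = 0"
| "tower (Suc n) = 2 ^ tower n"

lemma floor_log_le_tower: "V \<le> tower (Suc n) \<Longrightarrow> floor_log V \<le> tower n"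
  using floor_log_le_iff[of V "2 ^ tower n"] by simp

text \<open>Each half of the index range holds \<open>s\<close> shallow intervals, the
  \<open>depth s n\<close> ones of the recursive call, and \<open>s\<close> deep intervals.\<close>

fun depth :: "nat \<Rightarrow> nat \<Rightarrow> nat" where
  "depth s 0 = 0"
| "depth s (Suc n) = 2 * depth s n + 4 * s"

lemma depth_eq: "depth s n + 4 * s = 4 * s * 2 ^ n"
  by (induction n) auto

text \<open>A mixture of selections over the recursively drawn exponent \<open>r\<close>. The offset
  \<open>s + depth s n\<close> is the index in \<open>H\<close> that matches the last entry of the
  width sequence.\<close>

fun mech :: "real \<Rightarrow> nat \<Rightarrow> nat \<Rightarrow> nat \<Rightarrow> (nat \<Rightarrow> nat) \<Rightarrow> nat \<Rightarrow> real" where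
  "mech \<epsilon> s 0 V H p = (if p = 0 then 1 else 0)"
| "mech \<epsilon> s (Suc n) V H p =
     (\<Sum>r\<le>floor_log V. mech \<epsilon> s n (floor_log V) (width (depth s (Suc n)) s H) r *
        select \<epsilon> V (depth s (Suc n)) (s + depth s n) s (2 ^ r) H p)"

lemma mech_correct:
  assumes "V \<le> tower n" "seq V (depth s n) H" "0 < s"
  shows "pmass {..V} (mech \<epsilon> s n V H) \<and>
    (\<forall>p\<le>V. mech \<epsilon> s n V H p \<noteq> 0 \<longrightarrow> H (depth s n) \<le> p \<and> p \<le> H 0)"
  using assms(1,2)
proof (induction n arbitrary: V H)
  case 0
  then show ?case by (auto simp: pmass_def seq_def)
next
  case (Suc n)
  define D D' V' t where "D = depth s (Suc n)" and "D' = depth s n" and "V' = floor_log V" and "t = s + D'"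
  have D: "2 * (t + s) \<le> D" "s \<le> t" "s + D' \<le> D" "s \<le> D" by (auto simp: D_def D'_def t_def)
  have H: "seq V D H" using Suc.prems by (simp add: D_def)
  define P where "P = mech \<epsilon> s n V' (width D s H)"
  have P: "pmass {..V'} P"
    and P': "\<And>r. r \<le> V' \<Longrightarrow> P r \<noteq> 0 \<Longrightarrow> width D s H D' \<le> r \<and> r \<le> width D s H 0"
    using Suc.IH[OF floor_log_le_tower[OF Suc.prems(1)], of "width D s H"] seq_width[OF H D(3)]
    unfolding P_def V'_def D'_def by auto
  define S where "S r = select \<epsilon> V D t s (2 ^ r) H" for r
  have M: "mech \<epsilon> s (Suc n) V H p = (\<Sum>r\<le>V'. P r * S r p)" for p
    by (simp add: P_def S_def V'_def D_def D'_def t_def)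
  \<comment> \<open>An exponent of positive probability is at most the first width, so interval
    number \<open>s\<close> has at least \<open>2 ^ r\<close> points and contains a candidate of
    full score. For other exponents the selection may be the zero function, but its coefficient is
    0.\<close>
  have S1: "sum (S r) {..V} = 1" if "r \<le> V'" "P r \<noteq> 0" for r
    unfolding S_def
    using P'[OF that] power_le_width[of r "H s - H (D - s)"] assms(3) 
    by (intro sum_select[OF H D(1,2)]) (auto simp: width_def)
  have "(\<Sum>p\<le>V. \<Sum>r\<le>V'. P r * S r p) = (\<Sum>r\<le>V'. P r * sum (S r) {..V})"
    by (subst sum.swap) (simp add: sum_distrib_left)
  also have "\<dots> = (\<Sum>r\<le>V'. P r)"
    using S1 by (intro sum.cong) auto
  finally have "(\<Sum>p\<le>V. mech \<epsilon> s (Suc n) V H p) = 1"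
    unfolding M using P by (simp add: pmass_def)
  moreover have "0 \<le> mech \<epsilon> s (Suc n) V H p" if "p \<le> V" for p
    unfolding M using P that by (intro sum_nonneg mult_nonneg_nonneg) (auto simp: pmass_def S_def select_nonneg)
  moreover have "H D \<le> p \<and> p \<le> H 0" if p: "p \<le> V" "mech \<epsilon> s (Suc n) V H p \<noteq> 0" for p
  proof -
    obtain r where "S r p \<noteq> 0"
      using p(2) unfolding M by (metis (no_types, lifting) mult_zero_right sum.neutral)
    then show ?thesis unfolding S_def using select_range[OF H D(4)] by blast
  qed
  ultimately show ?case by (simp only: pmass_def D_def) auto
qed

text \<open>Composition over \<open>n\<close> levels, each paying the price of one
  selection.\<close>

lemma mech_close:
  assumes "V \<le> tower n" "seq V (depth s n) H" "seq V (depth s n) H'" "adj (depth s n) H H'" "s = m + 2"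
  shows "close (real n * (2 * \<epsilon>)) (real n * (4 / exp \<epsilon> ^ m)) {..V} (mech \<epsilon> s n V H) (mech \<epsilon> s n V H')"
  using assms(1-4)
proof (induction n arbitrary: V H H')
  case 0
  show ?case unfolding close_def by (intro exI[of _ "\<lambda>_. 0"]) auto
next
  case (Suc n)
  define D D' V' t where "D = depth s (Suc n)" and "D' = depth s n" and "V' = floor_log V" and "t = s + D'"
  have D: "2 * (t + s) \<le> D" "s \<le> t" "s + D' \<le> D" "s \<le> D" by (auto simp: D_def D'_def t_def)
  have H: "seq V D H" "seq V D H'" "adj D H H'" using Suc.prems by (simp_all add: D_def)
  have V': "V' \<le> tower n" unfolding V'_def using floor_log_le_tower Suc.prems(1) by blast
  define P where "P H = mech \<epsilon> s n V' (width D s H)" for H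
  define S where "S H r = select \<epsilon> V D t s (2 ^ r) H" for H r
  have M: "mech \<epsilon> s (Suc n) V H = (\<lambda>p. \<Sum>r\<le>V'. P H r * S H r p)" for H
    by (rule ext) (simp add: P_def S_def V'_def D_def D'_def t_def)
  have P: "pmass {..V'} (P H)"
    and P': "\<And>r. r \<le> V' \<Longrightarrow> P H r \<noteq> 0 \<Longrightarrow>
      2 ^ r \<le> H s - H (D - s) + 1 \<and> H t - H (D - t) < 2 * 2 ^ r" if "seq V D H" for H
  proof -
    have "pmass {..V'} (P H)" and
      *: "\<And>r. r \<le> V' \<Longrightarrow> P H r \<noteq> 0 \<Longrightarrow> width D s H D' \<le> r \<and> r \<le> width D s H 0"
      using mech_correct[OF V', of s "width D s H" \<epsilon>] seq_width[OF that D(3)] assms(5)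
      unfolding P_def V'_def D'_def by auto
    then show "pmass {..V'} (P H)" by simp
    fix r assume "r \<le> V'" "P H r \<noteq> 0"
    \<comment> \<open>The bound by the first width makes interval \<open>s\<close> long enough; the
      bound by the last width makes interval \<open>t\<close> short enough.\<close>
    from *[OF this] show "2 ^ r \<le> H s - H (D - s) + 1 \<and> H t - H (D - t) < 2 * 2 ^ r"
      by (auto simp: width_def t_def dest: power_le_width width_less_power)
  qed
  have "close (real n * (2 * \<epsilon>) + 2 * \<epsilon>) (real n * (4 / exp \<epsilon> ^ m) + 4 / exp \<epsilon> ^ m) {..V}
      (\<lambda>p. \<Sum>r\<le>V'. P H r * S H r p) (\<lambda>p. \<Sum>r\<le>V'. P H' r * S H' r p)"
  proof (rule close_compose)
    show "close (real n * (2 * \<epsilon>)) (real n * (4 / exp \<epsilon> ^ m)) {..V'} (P H) (P H')"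
      unfolding P_def
      using Suc.IH[OF V'] seq_width[OF H(1) D(3)] seq_width[OF H(2) D(3)] adj_width[OF H(3) D(3)]
      by (simp add: V'_def D'_def)
    show "close (2 * \<epsilon>) (4 / exp \<epsilon> ^ m) {..V} (S H r) (S H' r)"
      if "r \<in> {..V'}" "P H r \<noteq> 0" "P H' r \<noteq> 0" for r
      unfolding S_def using P'[OF H(1)] P'[OF H(2)] that D assms(5)
      by (intro close_select[OF H(1) _ _ H(2) _ _ H(3)]) auto
  qed (use P[OF H(1)] P[OF H(2)] in \<open>auto simp: pmass_def S_def select_nonneg sum_select_le\<close>)
  moreover have "real (Suc n) * c = real n * c + c" for c :: real
    by (simp add: algebra_simps)
  ultimately show ?case by (simp only: M)
qed

section \<open>The exponential mechanism\<close>

text \<open>With \<open>2 * n\<close> as last index, the intervals number 0 to \<open>n\<close>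
  shrink to the single point \<open>H n\<close>.\<close>

definition expo :: "real \<Rightarrow> nat \<Rightarrow> nat \<Rightarrow> (nat \<Rightarrow> nat) \<Rightarrow> nat \<Rightarrow> real" where
  "expo \<epsilon> V n H = normalized {..V} (\<lambda>p. exp \<epsilon> ^ shallow (2 * n) (n + 1) H p)"

lemma pmass_expo: "pmass {..V} (expo \<epsilon> V n H)"
proof -
  have "0 < (\<Sum>p\<le>V. exp \<epsilon> ^ shallow (2 * n) (n + 1) H p)" by (intro sum_pos) auto
  then show ?thesis
    by (auto simp: pmass_def expo_def sum_normalized intro!: normalized_nonneg)
qed

lemma close_expo:
  assumes "adj (2 * n) H H'" "0 \<le> \<epsilon>"
  shows "close (2 * \<epsilon>) 0 {..V} (expo \<epsilon> V n H) (expo \<epsilon> V n H')"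
proof -
  define w where "w H p = exp \<epsilon> ^ shallow (2 * n) (n + 1) H p" for H and p :: nat
  \<comment> \<open>Any positive lower bound on the totals works here, since the additive error is
    0.\<close>
  define z where "z = min (sum (w H) {..V}) (sum (w H') {..V})"
  have w: "w H p \<le> exp \<epsilon> * w H' p + 0" if "adj (2 * n) H H'" for H H' p
  proof -
    have "w H p \<le> exp \<epsilon> ^ Suc (shallow (2 * n) (n + 1) H' p)"
      unfolding w_def using shallow_le[OF that] assms(2) by (intro power_increasing) auto
    then show ?thesis by (simp add: w_def)
  qed
  have "0 < sum (w H) {..V}" for H unfolding w_def by (intro sum_pos) auto
  then have "0 < z" by (simp add: z_def)
  from close_normalized[OF _ _ _ _ _ _ this, of "{..V}" "w H" "w H'" "\<lambda>_. 0" \<epsilon> 0 "\<lambda>_. 0"]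
  show ?thesis
    using w[OF assms(1)] w[OF adj_sym[OF assms(1)]]
    by (simp add: z_def expo_def w_def[abs_def])
qed

text \<open>A point outside the outermost interval has weight 1, and there are at most
  \<open>V + 1\<close> of them, whereas \<open>H n\<close> alone has weight
  \<open>exp \<epsilon> ^ (n + 1)\<close>.\<close>

lemma expo_range:
  assumes "seq V (2 * n) H" "0 \<le> \<epsilon>"
  shows "1 - real (V + 1) / exp \<epsilon> ^ (n + 1) \<le> sum (expo \<epsilon> V n H) {H (2 * n)..H 0}"
proof -
  define w where "w p = exp \<epsilon> ^ shallow (2 * n) (n + 1) H p" for p
  define G where "G = {H (2 * n)..H 0}"
  have G: "G \<subseteq> {..V}" using assms(1) by (auto simp: seq_def G_def)
  have "{i. i < n + 1 \<and> H (2 * n - i) \<le> H n \<and> H n \<le> H i} = {..<n + 1}"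
    by (auto intro!: seq_mono[OF assms(1)])
  then have "w (H n) = exp \<epsilon> ^ (n + 1)" by (simp add: w_def shallow_def)
  moreover have "w (H n) \<le> sum w {..V}"
    using seq_le[OF assms(1), of n] by (intro member_le_sum) (auto simp: w_def)
  ultimately have Z: "exp \<epsilon> ^ (n + 1) \<le> sum w {..V}" by simp
  have "expo \<epsilon> V n H p \<le> 1 / exp \<epsilon> ^ (n + 1)" if "p \<in> {..V} - G" for p
  proof -
    have "shallow (2 * n) (n + 1) H p = 0"
      using shallow_pos[OF assms(1), of "n + 1" p] that by (auto simp: G_def)
    then have "expo \<epsilon> V n H p = 1 / sum w {..V}"
      by (simp add: expo_def normalized_def w_def)
    also have "\<dots> \<le> 1 / exp \<epsilon> ^ (n + 1)"
      using Z by (intro divide_left_mono mult_pos_pos less_le_trans[OF _ Z]) auto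
    finally show ?thesis .
  qed
  then have "sum (expo \<epsilon> V n H) ({..V} - G) \<le> real (card ({..V} - G)) * (1 / exp \<epsilon> ^ (n + 1))"
    using sum_bounded_above by blast
  also have "\<dots> \<le> real (V + 1) * (1 / exp \<epsilon> ^ (n + 1))"
    using card_mono[of "{..V}" "{..V} - G"] by (intro mult_right_mono) auto
  finally show ?thesis
    using pmass_expo[of V \<epsilon> n H] sum.subset_diff[OF G, of "expo \<epsilon> V n H"]
    by (simp add: pmass_def G_def)
qed


section \<open>Interleaving sequences from down neighborhoods\<close>

definition inner_max :: "('a set \<Rightarrow> nat) \<Rightarrow> 'a set \<Rightarrow> nat \<Rightarrow> nat \<Rightarrow> nat" where
  "inner_max g x j d = Min ((\<lambda>z. Max (g ` DN d z)) ` DN j x)"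

lemma finite_DN: "finite x \<Longrightarrow> finite (DN l x)"
  by (auto simp: DN_def intro: finite_subset[of _ "Pow x"])

lemma self_in_DN: "x \<in> DN l x"
  by (simp add: DN_def)

lemma finite_in_DN: "finite x \<Longrightarrow> z \<in> DN l x \<Longrightarrow> finite z"
  by (auto simp: DN_def intro: finite_subset)

lemma DN_mono: "l \<le> l' \<Longrightarrow> DN l x \<subseteq> DN l' x"
  by (auto simp: DN_def)

lemma DN_trans:
  assumes "finite x" "z \<in> DN j x" "w \<in> DN d z"
  shows "w \<in> DN (j + d) x"
proof -
  have "card (x - w) \<le> card ((x - z) \<union> (z - w))"
    using assms by (intro card_mono) (auto simp: DN_def intro: finite_subset)
  also have "\<dots> \<le> card (x - z) + card (z - w)" by (rule card_Un_le)
  also have "\<dots> \<le> j + d" using assms by (auto simp: DN_def)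
  finally show ?thesis using assms by (auto simp: DN_def)
qed

lemma DN_insert:
  assumes "finite x"
  shows "DN j x \<subseteq> DN (Suc j) (insert i x)"
proof
  fix z assume z: "z \<in> DN j x"
  have "card (insert i x - z) \<le> card (insert i (x - z))"
    using assms by (intro card_mono) auto
  also have "\<dots> \<le> Suc (card (x - z))" by (rule card_insert_le_m1) auto
  finally show "z \<in> DN (Suc j) (insert i x)" using z by (auto simp: DN_def)
qed

text \<open>Intersecting with \<open>x\<close> drops at most the element \<open>i\<close>, which
  costs one deletion from \<open>z\<close>.\<close>

lemma DN_Int:
  assumes "finite x" "z \<in> DN j (insert i x)"
  shows "z \<inter> x \<in> DN j x" "DN d (z \<inter> x) \<subseteq> DN (Suc d) z"
proof -
  have "card (x - z \<inter> x) \<le> card (insert i x - z)"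
    using assms by (intro card_mono) auto
  then show "z \<inter> x \<in> DN j x" using assms by (auto simp: DN_def)
  have "z = z \<inter> x \<or> z = insert i (z \<inter> x)" using assms(2) by (auto simp: DN_def)
  then show "DN d (z \<inter> x) \<subseteq> DN (Suc d) z"
  proof
    assume "z = z \<inter> x"
    then show ?thesis using DN_mono[of d "Suc d" z] by simp
  next
    assume "z = insert i (z \<inter> x)"
    then show ?thesis using DN_insert[of "z \<inter> x" d i] assms(1) by simp
  qed
qed

text \<open>For a minimum of maxima it suffices to match each choice \<open>z\<close> on the right
  with a choice on the left whose inner range is smaller.\<close>

lemma inner_max_le:
  assumes "finite x" "finite y"
    and "\<And>z. z \<in> DN j x \<Longrightarrow> \<exists>z'\<in>DN j' y. DN d' z' \<subseteq> DN d z"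
  shows "inner_max g y j' d' \<le> inner_max g x j d"
  unfolding inner_max_def
proof (rule Min.boundedI)
  show "finite ((\<lambda>z. Max (g ` DN d z)) ` DN j x)" using finite_DN[OF assms(1)] by simp
  show "(\<lambda>z. Max (g ` DN d z)) ` DN j x \<noteq> {}" using self_in_DN by auto
  fix v assume "v \<in> (\<lambda>z. Max (g ` DN d z)) ` DN j x"
  then obtain z where z: "z \<in> DN j x" "v = Max (g ` DN d z)" by blast
  obtain z' where z': "z' \<in> DN j' y" "DN d' z' \<subseteq> DN d z" using assms(3)[OF z(1)] by blast
  have "Min ((\<lambda>z. Max (g ` DN d' z)) ` DN j' y) \<le> Max (g ` DN d' z')"
    using z' finite_DN[OF assms(2)] by (intro Min_le) auto
  also have "\<dots> \<le> v" unfolding z(2)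
    using z' self_in_DN[of z' d'] finite_DN[OF finite_in_DN[OF assms(1) z(1)]]
    by (intro Max_mono) auto
  finally show "Min ((\<lambda>z. Max (g ` DN d' z)) ` DN j' y) \<le> v" .
qed

text \<open>The minimum with \<open>D\<close> keeps the queries inside \<open>DN D x\<close> for the irrelevant indices \<open>j > D\<close>.\<close>

definition hseq :: "nat \<Rightarrow> ('a set \<Rightarrow> nat) \<Rightarrow> 'a set \<Rightarrow> nat \<Rightarrow> nat" where
  "hseq D g x j = inner_max g x (min j D) (D - j)"

lemma hseq_antimono:
  assumes "finite x" "i \<le> j" "j \<le> D"
  shows "hseq D g x j \<le> hseq D g x i"
  unfolding hseq_def
proof (rule inner_max_le[OF assms(1,1)])
  fix z assume z: "z \<in> DN (min i D) x"
  show "\<exists>z'\<in>DN (min j D) x. DN (D - j) z' \<subseteq> DN (D - i) z"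
    using z assms DN_mono[of "min i D" "min j D" x] DN_mono[of "D - j" "D - i" z]
    by (intro bexI[of _ z]) auto
qed

text \<open>A step from \<open>j\<close> to \<open>Suc j\<close> moves one deletion from the inner
  to the outer budget. From \<open>x\<close> to \<open>insert i x\<close>, the extra outer deletion
  removes \<open>i\<close>; in the other direction \<open>z\<close> is replaced by
  \<open>z \<inter> x\<close>, and the inner deletion given up accounts for
  \<open>i\<close>.\<close>

lemma adj_hseq_insert:
  assumes "finite x"
  shows "adj D (hseq D g x) (hseq D g (insert i x))"
proof -
  have "hseq D g x (Suc j) \<le> hseq D g (insert i x) j" if "j < D" for j
    unfolding hseq_def
  proof (rule inner_max_le)
    fix z assume "z \<in> DN (min j D) (insert i x)"
    then have "z \<inter> x \<in> DN (min j D) x" "DN (D - Suc j) (z \<inter> x) \<subseteq> DN (Suc (D - Suc j)) z"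
      using DN_Int[OF assms] by blast+
    then show "\<exists>z'\<in>DN (min (Suc j) D) x. DN (D - Suc j) z' \<subseteq> DN (D - j) z"
      using that DN_mono[of "min j D" "min (Suc j) D" x]
      by (intro bexI[of _ "z \<inter> x"]) (auto simp: Suc_diff_Suc)
  qed (use assms in auto)
  moreover have "hseq D g (insert i x) (Suc j) \<le> hseq D g x j" if "j < D" for j
    unfolding hseq_def
  proof (rule inner_max_le)
    fix z assume z: "z \<in> DN (min j D) x"
    show "\<exists>z'\<in>DN (min (Suc j) D) (insert i x). DN (D - Suc j) z' \<subseteq> DN (D - j) z"
      using that z DN_insert[OF assms, of j i] DN_mono[of "D - Suc j" "D - j" z]
      by (intro bexI[of _ z]) (auto simp: min_def)
  qed (use assms in auto)
  ultimately show ?thesis by (simp add: adj_def)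
qed

lemma adj_hseq:
  assumes "finite x" "finite y" "neighbors U x y"
  shows "adj D (hseq D g x) (hseq D g y)"
proof -
  obtain i where "x = insert i y \<or> y = insert i x"
    using assms(3) by (auto simp: neighbors_def)
  then show ?thesis using adj_hseq_insert assms adj_sym by metis
qed

lemma hseq_0_le:
  assumes "finite x"
  shows "hseq D g x 0 \<le> Max (g ` DN D x)"
  unfolding hseq_def inner_max_def
  using assms self_in_DN by (intro Min_le) (auto simp: finite_DN)

lemma hseq_ge:
  assumes "finite x"
  shows "Min (g ` DN D x) \<le> hseq D g x D"
proof -
  have "Min (g ` DN D x) \<le> Max (g ` DN 0 z)" if z: "z \<in> DN D x" for z
  proof -
    have "Min (g ` DN D x) \<le> g z" using z finite_DN[OF assms] by (intro Min_le) auto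
    also have "\<dots> \<le> Max (g ` DN 0 z)"
      using z self_in_DN finite_DN[OF finite_in_DN[OF assms z]] by (intro Max_ge) auto
    finally show ?thesis .
  qed
  then show ?thesis unfolding hseq_def inner_max_def
    using assms self_in_DN by (intro Min.boundedI) (auto simp: finite_DN)
qed

lemma seq_hseq:
  assumes "finite x" "\<And>z. g z \<le> V"
  shows "seq V D (hseq D g x)"
proof -
  have "hseq D g x 0 \<le> Max (g ` DN D x)" by (rule hseq_0_le[OF assms(1)])
  also have "\<dots> \<le> V" using assms self_in_DN[of x] finite_DN[of x] by (subst Max_le_iff) auto
  finally show ?thesis using hseq_antimono[OF assms(1)] by (auto simp: seq_def)
qed

text \<open>This allows the sequence to be computed from a table of answers that is correct only on
  \<open>DN D x\<close>.\<close>

lemma hseq_cong: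
  assumes "finite x" "\<And>z. z \<in> DN D x \<Longrightarrow> g z = g' z"
  shows "hseq D g x = hseq D g' x"
proof
  fix j
  have "Max (g ` DN (D - j) z) = Max (g' ` DN (D - j) z)" if z: "z \<in> DN (min j D) x" for z
  proof -
    have "w \<in> DN D x" if "w \<in> DN (D - j) z" for w
      using DN_trans[OF assms(1) z that] by (cases "j \<le> D") (auto simp: min_def)
    then have "g ` DN (D - j) z = g' ` DN (D - j) z" using assms(2) by (intro image_cong) auto
    then show ?thesis by simp
  qed
  then have "(\<lambda>z. Max (g ` DN (D - j) z)) ` DN (min j D) x = (\<lambda>z. Max (g' ` DN (D - j) z)) ` DN (min j D) x"
    by (intro image_cong) auto
  then show "hseq D g x j = hseq D g' x j"
    unfolding hseq_def inner_max_def by simp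
qed

section \<open>Sampling and querying\<close>

definition unif :: "real measure" where
  "unif = restrict_space lborel {0..<1}"

lemma space_unif: "space unif = {0..<1}"
  by (simp add: unif_def space_restrict_space)

lemma emeasure_unif: "A \<in> sets borel \<Longrightarrow> A \<subseteq> {0..<1} \<Longrightarrow> emeasure unif A = emeasure lborel A"
  unfolding unif_def by (subst emeasure_restrict_space) auto

lemma prob_space_unif: "prob_space unif"
  by (rule prob_spaceI) (simp add: space_unif emeasure_unif)

text \<open>Inverse transform sampling, written as a count: measurability is immediate, and the
  value is at most \<open>V\<close> for every \<open>P\<close>.\<close>

definition sample :: "nat \<Rightarrow> (nat \<Rightarrow> real) \<Rightarrow> real \<Rightarrow> nat" where
  "sample V P \<omega> = card {i\<in>{1..V}. sum P {..<i} \<le> \<omega>}"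

lemma measurable_sample: "sample V P \<in> unif \<rightarrow>\<^sub>M count_space UNIV"
proof -
  have "sample V P = (\<lambda>\<omega>. \<Sum>i\<in>{1..V}. if sum P {..<i} \<le> \<omega> then 1 else 0)"
    by (rule ext) (simp add: sample_def sum.If_cases Int_def)
  also have "\<dots> \<in> lborel \<rightarrow>\<^sub>M count_space UNIV" by measurable
  finally show ?thesis unfolding unif_def by (rule measurable_restrict_space1)
qed

lemma sample_eq:
  assumes "\<And>i. i \<le> V \<Longrightarrow> 0 \<le> P i" "p \<le> V" "sum P {..<p} \<le> \<omega>" "\<omega> < sum P {..p}"
  shows "sample V P \<omega> = p"
proof -
  have mono: "sum P {..<i} \<le> sum P {..<j}" if "i \<le> j" "j \<le> Suc V" for i j
    using that assms(1) by (intro sum_mono2) auto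
  have "sum P {..<i} \<le> \<omega> \<longleftrightarrow> i \<le> p" if "i \<in> {1..V}" for i
  proof
    assume "sum P {..<i} \<le> \<omega>"
    then have "sum P {..<i} < sum P {..<Suc p}" using assms(4) by (simp add: lessThan_Suc_atMost)
    then show "i \<le> p" using mono[of "Suc p" i] that by force
  next
    assume "i \<le> p"
    then show "sum P {..<i} \<le> \<omega>" using mono[of i p] assms(2,3) by auto
  qed
  then have "{i\<in>{1..V}. sum P {..<i} \<le> \<omega>} = {1..p}" using assms(2) by auto
  then show ?thesis by (simp add: sample_def)
qed

lemma measure_sample:
  assumes "pmass {..V} P"
  shows "measure unif {\<omega>\<in>space unif. sample V P \<omega> \<in> E} = sum P {p. p \<le> V \<and> p \<in> E}"
proof -
  have P: "\<And>i. i \<le> V \<Longrightarrow> 0 \<le> P i" "sum P {..V} = 1" using assms by (auto simp: pmass_def)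
  \<comment> \<open>These half-open intervals of length \<open>P p\<close> partition the unit
    interval, and \<open>sample\<close> is constantly \<open>p\<close> on
    \<open>J p\<close>.\<close>
  define J where "J p = {sum P {..<p}..<sum P {..p}}" for p
  have J01: "J p \<subseteq> {0..<1}" if "p \<le> V" for p
  proof -
    have "0 \<le> sum P {..<p}" using P that by (intro sum_nonneg) auto
    moreover have "sum P {..p} \<le> sum P {..V}" using P that by (intro sum_mono2) auto
    ultimately show ?thesis using P by (auto simp: J_def)
  qed
  have sample: "sample V P \<omega> = p" if "p \<le> V" "\<omega> \<in> J p" for p \<omega>
    using that sample_eq[OF P(1)] by (simp add: J_def)
  have cover: "\<exists>p\<le>V. \<omega> \<in> J p" if "\<omega> \<in> {0..<1}" for \<omega>
  proof -
    define p where "p = (LEAST p. \<omega> < sum P {..p})"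
    have "\<omega> < sum P {..V}" using that P by simp
    then have p: "p \<le> V" "\<omega> < sum P {..p}"
      unfolding p_def by (auto intro: Least_le LeastI)
    moreover have "sum P {..<p} \<le> \<omega>"
    proof (cases p)
      case 0
      then show ?thesis using that by simp
    next
      case (Suc q)
      then have "\<not> \<omega> < sum P {..q}" using not_less_Least[of q "\<lambda>p. \<omega> < sum P {..p}"] unfolding p_def by auto
      then show ?thesis by (simp add: Suc lessThan_Suc_atMost)
    qed
    ultimately show ?thesis by (auto simp: J_def)
  qed
  have "{\<omega>\<in>space unif. sample V P \<omega> \<in> E} = (\<Union>p\<in>{p. p \<le> V \<and> p \<in> E}. J p)"
  proof (intro equalityI subsetI)
    fix \<omega> assume \<omega>: "\<omega> \<in> {\<omega>\<in>space unif. sample V P \<omega> \<in> E}"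
    then obtain p where "p \<le> V" "\<omega> \<in> J p" using cover by (auto simp: space_unif)
    then show "\<omega> \<in> (\<Union>p\<in>{p. p \<le> V \<and> p \<in> E}. J p)" using \<omega> sample by auto
  next
    fix \<omega> assume "\<omega> \<in> (\<Union>p\<in>{p. p \<le> V \<and> p \<in> E}. J p)"
    then show "\<omega> \<in> {\<omega>\<in>space unif. sample V P \<omega> \<in> E}"
      using sample J01 by (fastforce simp: space_unif)
  qed
  moreover have "measure unif (\<Union>p\<in>{p. p \<le> V \<and> p \<in> E}. J p) = (\<Sum>p\<in>{p. p \<le> V \<and> p \<in> E}. measure unif (J p))"
  proof (rule measure_finite_Union)
    show "J ` {p. p \<le> V \<and> p \<in> E} \<subseteq> sets unif"
      using J01 by (auto simp: unif_def sets_restrict_space_iff J_def)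
    show "disjoint_family_on J {p. p \<le> V \<and> p \<in> E}"
      unfolding disjoint_family_on_def using sample by blast
    show "emeasure unif (J p) \<noteq> \<infinity>" if "p \<in> {p. p \<le> V \<and> p \<in> E}" for p
      using finite_measure.emeasure_finite[OF prob_space.finite_measure[OF prob_space_unif]] by auto
  qed simp
  moreover have "measure unif (J p) = P p" if "p \<le> V" for p
  proof -
    have "sum P {..p} - sum P {..<p} = P p" by (simp flip: lessThan_Suc_atMost)
    moreover have "sum P {..<p} \<le> sum P {..p}" using P(1) that by (intro sum_mono2) auto
    moreover have "emeasure unif (J p) = emeasure lborel (J p)"
      using J01[OF that] by (intro emeasure_unif) (auto simp: J_def)
    ultimately show ?thesis by (simp add: measure_def J_def)
  qed
  ultimately show ?thesis by (auto intro: sum.cong)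
qed

text \<open>Nonadaptive querying: the answers overwrite the default table \<open>g\<close>, which is
  then handed to \<open>k\<close>.\<close>

primrec query_all :: "'q list \<Rightarrow> ('q \<Rightarrow> 'r) \<Rightarrow> (('q \<Rightarrow> 'r) \<Rightarrow> 'o) \<Rightarrow> ('q, 'r, 'o) query_alg" where
  "query_all [] g k = Output (k g)"
| "query_all (q # qs) g k = Query q (\<lambda>r. query_all qs (g(q := r)) k)"

lemma run_query_all: "run f (query_all qs g k) = k (\<lambda>q. if q \<in> set qs then f q else g q)"
  by (induction qs arbitrary: g) (auto intro!: arg_cong[of _ _ k])

lemma queries_query_all: "queries f (query_all qs g k) = set qs"
  by (induction qs arbitrary: g) auto


section \<open>From mechanisms on sequences to wrappers\<close>

lemma enumerate_range:
  fixes Y :: "real set"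
  assumes "finite Y" "Y \<noteq> {}" "V = card Y - 1"
  obtains e :: "nat \<Rightarrow> real" and r :: "real \<Rightarrow> nat"
  where "\<And>i j. i \<le> j \<Longrightarrow> j \<le> V \<Longrightarrow> e i \<le> e j" "\<And>v. r v \<le> V" "\<And>v. v \<in> Y \<Longrightarrow> e (r v) = v"
proof -
  define ys where "ys = sorted_list_of_set Y"
  have ys: "sorted ys" "set ys = Y" "length ys = Suc V"
    using assms card_gt_0_iff[of Y] by (auto simp: ys_def)
  \<comment> \<open>Values outside \<open>Y\<close> get rank 0, because privacy is required for
    every function, including those that leave the range.\<close>
  define r where "r v = (if v \<in> Y then SOME i. i \<le> V \<and> ys ! i = v else 0)" for v
  have "r v \<le> V \<and> ys ! r v = v" if "v \<in> Y" for v
  proof -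
    have "\<exists>i. i \<le> V \<and> ys ! i = v"
      using that ys by (metis in_set_conv_nth less_Suc_eq_le)
    from someI_ex[OF this] show ?thesis using that by (simp add: r_def)
  qed
  moreover have "r v \<le> V" if "v \<notin> Y" for v using that by (simp add: r_def)
  moreover have "ys ! i \<le> ys ! j" if "i \<le> j" "j \<le> V" for i j
    using that ys by (intro sorted_nth_mono) auto
  ultimately show thesis using that[of "\<lambda>i. ys ! i" r] by blast
qed

lemma wrapper_exists:
  fixes U :: "'a set" and Y :: "real set"
  assumes Y: "finite Y" "Y \<noteq> {}" "V = card Y - 1"
    and M: "\<And>H. seq V D H \<Longrightarrow> pmass {..V} (M H)"
    and cl: "\<And>H H'. seq V D H \<Longrightarrow> seq V D H' \<Longrightarrow> adj D H H' \<Longrightarrow> close \<epsilon> \<delta> {..V} (M H) (M H')"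
    and ut: "\<And>H. seq V D H \<Longrightarrow> 1 - \<beta> \<le> sum (M H) {H D..H 0}"
  shows "\<exists>W :: 'a wrapper. privacy_wrapper U \<epsilon> \<delta> W \<and> down_local U D W \<and>
    (\<forall>f. (\<forall>z\<in>Fpow U. f z \<in> Y) \<longrightarrow>
      (\<forall>x\<in>Fpow U.
        measure (wrapper_output W f x) (Some ` {Min (f ` DN D x)..Max (f ` DN D x)}) \<ge> 1 - \<beta>))"
proof -
  obtain e :: "nat \<Rightarrow> real" and r where e: "\<And>i j. i \<le> j \<Longrightarrow> j \<le> V \<Longrightarrow> e i \<le> e j"
    and r: "\<And>v. r v \<le> V" "\<And>v. v \<in> Y \<Longrightarrow> e (r v) = v"
    using enumerate_range[OF Y] by blast
  define qs where "qs x = (SOME qs. set qs = DN D x)" for x :: "'a set"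
  have qs: "set (qs x) = DN D x" if "finite x" for x :: "'a set"
    unfolding qs_def using someI_ex[OF finite_list[OF finite_DN[OF that]]] .
  define h where "h f x = hseq D (\<lambda>z. r (f z)) x" for f :: "'a set \<Rightarrow> real" and x
  \<comment> \<open>All of \<open>DN D x\<close> is queried, so the default answer 0 never
    influences the sequence.\<close>
  define W :: "'a wrapper" where "W = \<lparr>seed = unif,
    alg = \<lambda>\<omega> x. query_all (qs x) (\<lambda>_. 0) (\<lambda>t. Some (e (sample V (M (h t x)) \<omega>)))\<rparr>"
  have run: "run f (alg W \<omega> x) = Some (e (sample V (M (h f x)) \<omega>))" if "finite x" for f \<omega> x
  proof -
    have "h (\<lambda>q. if q \<in> set (qs x) then f q else 0) x = h f x"
      unfolding h_def using that by (intro hseq_cong) (auto simp: qs)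
    then show ?thesis by (simp add: W_def run_query_all)
  qed
  have queries: "queries f (alg W \<omega> x) = DN D x" if "finite x" for f \<omega> x
    using that by (simp add: W_def queries_query_all qs)
  have hs: "seq V D (h f x)" if "finite x" for f x
    unfolding h_def by (rule seq_hseq[OF that r(1)])
  have seed: "seed W = unif" by (simp add: W_def)
  have meas: "(\<lambda>\<omega>. run f (alg W \<omega> x)) \<in> unif \<rightarrow>\<^sub>M out_space" if "finite x" for f x
    unfolding run[OF that]
    by (rule measurable_compose[OF measurable_sample]) simp
  have out: "measure (wrapper_output W f x) E = sum (M (h f x)) {p. p \<le> V \<and> Some (e p) \<in> E}"
    if "finite x" "E \<in> sets out_space" for f x E
  proof -
    have "measure (wrapper_output W f x) E =
        measure unif {\<omega>\<in>space unif. sample V (M (h f x)) \<omega> \<in> {p. Some (e p) \<in> E}}"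
      unfolding wrapper_output_def seed using measure_distr[OF meas[OF that(1)] that(2)] run[OF that(1)]
      by (simp add: vimage_def Int_def conj_commute)
    then show ?thesis using measure_sample[OF M[OF hs[OF that(1)]], of f "{p. Some (e p) \<in> E}"] by simp
  qed
  have "privacy_wrapper U \<epsilon> \<delta> W"
    unfolding privacy_wrapper_def
  proof (intro conjI allI ballI)
    show "prob_space (seed W)" by (simp add: seed prob_space_unif)
    show "(\<lambda>\<omega>. run f (alg W \<omega> x)) \<in> seed W \<rightarrow>\<^sub>M out_space" if "x \<in> Fpow U" for f x
      using meas that by (simp add: seed Fpow_def)
    show "queries f (alg W \<omega> x) \<subseteq> Fpow U" if "x \<in> Fpow U" for f x \<omega>
      using that by (auto simp: queries Fpow_def DN_def intro: finite_subset)
    show "differentially_private U out_space \<epsilon> \<delta> (wrapper_output W f)" for f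
      unfolding differentially_private_def
    proof (intro conjI ballI impI)
      show "wrapper_output W f x \<in> space (prob_algebra out_space)" if "x \<in> Fpow U" for x
        unfolding space_prob_algebra wrapper_output_def seed
        using prob_space.prob_space_distr[OF prob_space_unif meas] that by (simp add: Fpow_def)
      fix x y E assume xy: "x \<in> Fpow U" "y \<in> Fpow U" "neighbors U x y" and E: "E \<in> sets out_space"
      have fin: "finite x" "finite y" using xy by (auto simp: Fpow_def)
      have "adj D (h f x) (h f y)" unfolding h_def by (rule adj_hseq[OF fin xy(3)])
      from cl[OF hs[OF fin(1)] hs[OF fin(2)] this] obtain c where
        c: "\<forall>p\<in>{..V}. 0 \<le> c p \<and> M (h f x) p \<le> exp \<epsilon> * M (h f y) p + c p" "sum c {..V} \<le> \<delta>"
        unfolding close_def by blast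
      let ?G = "{p. p \<le> V \<and> Some (e p) \<in> E}"
      have "sum (M (h f x)) ?G \<le> (\<Sum>p\<in>?G. exp \<epsilon> * M (h f y) p + c p)"
        using c(1) by (intro sum_mono) auto
      also have "\<dots> = exp \<epsilon> * sum (M (h f y)) ?G + sum c ?G"
        by (simp add: sum.distrib sum_distrib_left)
      also have "sum c ?G \<le> sum c {..V}" using c(1) by (intro sum_mono2) auto
      finally show "measure (wrapper_output W f x) E \<le> exp \<epsilon> * measure (wrapper_output W f y) E + \<delta>"
        using c(2) by (simp add: out fin E)
    qed
  qed
  moreover have "down_local U D W"
    unfolding down_local_def by (auto simp: queries Fpow_def)
  moreover have "measure (wrapper_output W f x) (Some ` {Min (f ` DN D x)..Max (f ` DN D x)}) \<ge> 1 - \<beta>"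
    if f: "\<forall>z\<in>Fpow U. f z \<in> Y" and x: "x \<in> Fpow U" for f x
  proof -
    let ?E = "Some ` {Min (f ` DN D x)..Max (f ` DN D x)}"
    let ?H = "h f x"
    have fin: "finite x" using x by (simp add: Fpow_def)
    have finD: "finite (DN D x)" "DN D x \<noteq> {}" using finite_DN[OF fin] self_in_DN by auto
    have fY: "e (r (f z)) = f z" if "z \<in> DN D x" for z
    proof -
      have "z \<in> Fpow U" using that x by (auto simp: Fpow_def DN_def intro: finite_subset)
      then show ?thesis using f r(2) by simp
    qed
    have "?E \<in> sets out_space"
      by (simp add: sets_out_space inj_vimage_image_eq)
    then have eq: "measure (wrapper_output W f x) ?E = sum (M ?H) {p. p \<le> V \<and> Some (e p) \<in> ?E}"
      by (rule out[OF fin])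
    have "{?H D..?H 0} \<subseteq> {p. p \<le> V \<and> Some (e p) \<in> ?E}"
    proof
      fix p assume p: "p \<in> {?H D..?H 0}"
      have pV: "p \<le> V" using p seq_le[OF hs[OF fin], of 0] by (meson atLeastAtMost_iff le0 order_trans)
      \<comment> \<open>The extreme ranks are attained, so \<open>p\<close> lies between the ranks
        of two actual values of \<open>f\<close>, and the monotone \<open>e\<close> carries this
        back to the reals.\<close>
      have "Min ((\<lambda>z. r (f z)) ` DN D x) \<in> (\<lambda>z. r (f z)) ` DN D x"
        "Max ((\<lambda>z. r (f z)) ` DN D x) \<in> (\<lambda>z. r (f z)) ` DN D x"
        using finD by (auto intro!: Min_in Max_in)
      moreover have "Min ((\<lambda>z. r (f z)) ` DN D x) \<le> p" "p \<le> Max ((\<lambda>z. r (f z)) ` DN D x)"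
        using p hseq_ge[OF fin, of "\<lambda>z. r (f z)" D] hseq_0_le[OF fin, of D "\<lambda>z. r (f z)"]
        by (auto simp: h_def)
      ultimately obtain z1 z2 where z: "z1 \<in> DN D x" "r (f z1) \<le> p" "z2 \<in> DN D x" "p \<le> r (f z2)"
        by auto
      have "Min (f ` DN D x) \<le> f z1" "f z1 \<le> e p"
        using z e[OF z(2) pV] fY finD by auto
      moreover have "e p \<le> f z2" "f z2 \<le> Max (f ` DN D x)"
        using z e[OF z(4) r(1)] fY finD by auto
      ultimately show "p \<in> {p. p \<le> V \<and> Some (e p) \<in> ?E}" using pV by auto
    qed
    then have "sum (M ?H) {?H D..?H 0} \<le> sum (M ?H) {p. p \<le> V \<and> Some (e p) \<in> ?E}"
      using M[OF hs[OF fin], of f] by (intro sum_mono2) (auto simp: pmass_def)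
    then show ?thesis unfolding eq using ut[OF hs[OF fin], of f] by linarith
  qed
  ultimately show ?thesis by blast
qed

lemma pure_wrapper_exists:
  fixes U :: "'a set" and Y :: "real set"
  assumes Y: "finite Y" "Y \<noteq> {}" and \<epsilon>: "0 < \<epsilon>" and \<beta>: "0 < \<beta>" "\<beta> < 1"
  shows "\<exists>l (W :: 'a wrapper). privacy_wrapper U \<epsilon> 0 W \<and> down_local U l W \<and>
    (\<forall>f. (\<forall>z\<in>Fpow U. f z \<in> Y) \<longrightarrow>
      (\<forall>x\<in>Fpow U.
        measure (wrapper_output W f x) (Some ` {Min (f ` DN l x)..Max (f ` DN l x)}) \<ge> 1 - \<beta>)) \<and>
    real l \<le> 4 * (1 / \<epsilon> * ln (real (card Y) / \<beta>))"
proof -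
  define V where "V = card Y - 1"
  define L where "L = ln (real (card Y) / \<beta>)"
  have k: "1 \<le> card Y" using Y by (simp add: Suc_leI card_gt_0_iff)
  have "1 \<le> real (card Y) / \<beta>" using k \<beta> by (simp add: field_simps)
  then have L: "0 \<le> L" "exp L = real (card Y) / \<beta>" by (auto simp: L_def)
  \<comment> \<open>The mechanism is run with \<open>\<epsilon> / 2\<close> because it costs twice
    its parameter. Rounding down suffices since the exponent in \<open>expo_range\<close> is
    \<open>n + 1\<close>, and it leaves no additive constant in the bound on
    \<open>2 * n\<close>.\<close>
  define n where "n = nat \<lfloor>2 * L / \<epsilon>\<rfloor>"
  have n: "real n \<le> 2 * L / \<epsilon>" "2 * L / \<epsilon> \<le> real n + 1"
    using L(1) \<epsilon> by (auto simp: n_def)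
  have "1 - \<beta> \<le> 1 - real (V + 1) / exp (\<epsilon> / 2) ^ (n + 1)"
  proof -
    have "L \<le> real (n + 1) * (\<epsilon> / 2)" using n(2) \<epsilon> by (simp add: field_simps)
    then have "exp L \<le> exp (real (n + 1) * (\<epsilon> / 2))" by (simp only: exp_le_cancel_iff)
    then have "real (card Y) / \<beta> \<le> exp (\<epsilon> / 2) ^ (n + 1)"
      by (simp only: L(2) exp_of_nat_mult)
    then have "real (card Y) / exp (\<epsilon> / 2) ^ (n + 1) \<le> \<beta>"
      using \<beta>(1) by (simp add: field_simps)
    then show ?thesis using k by (simp add: V_def)
  qed
  then have ut: "1 - \<beta> \<le> sum (expo (\<epsilon> / 2) V n H) {H (2 * n)..H 0}" if "seq V (2 * n) H" for H
    using expo_range[OF that, of "\<epsilon> / 2"] \<epsilon> by linarith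
  have cl: "close \<epsilon> 0 {..V} (expo (\<epsilon> / 2) V n H) (expo (\<epsilon> / 2) V n H')" if "adj (2 * n) H H'" for H H'
    using close_expo[OF that, of "\<epsilon> / 2" V] \<epsilon> by simp
  have "real (2 * n) \<le> 4 * (1 / \<epsilon> * L)" using n(1) by simp
  then show ?thesis
    unfolding L_def using wrapper_exists[where D = "2 * n" and M = "expo (\<epsilon> / 2) V n" and U = U, OF Y V_def pmass_expo cl ut]
    by blast
qed

section \<open>Parameters\<close>

lemma powr_tower: "2 powr real (tower n) = real (tower (Suc n))"
  by (simp add: powr_realpow)

text \<open>Undo the logarithms one at a time, starting from \<open>tower 1 = 1\<close>. The first
  assumption keeps their arguments positive.\<close>

lemma le_tower:
  assumes "\<And>j. j < n \<Longrightarrow> 1 < (log 2 ^^ j) v" "(log 2 ^^ n) v \<le> 1"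
  shows "v \<le> real (tower (Suc n))"
  using assms
proof (induction n arbitrary: v)
  case 0
  then show ?case by simp
next
  case (Suc n)
  have v: "1 < v" using Suc.prems(1)[of 0] by simp
  have "log 2 v \<le> real (tower (Suc n))"
  proof (rule Suc.IH)
    show "1 < (log 2 ^^ j) (log 2 v)" if "j < n" for j
      using Suc.prems(1)[of "Suc j"] that by (simp add: funpow_swap1)
    show "(log 2 ^^ n) (log 2 v) \<le> 1"
      using Suc.prems(2) by (simp add: funpow_swap1)
  qed
  then have "v \<le> 2 powr real (tower (Suc n))" using v by (simp add: log_le_iff del: tower.simps)
  then show ?case by (simp only: powr_tower)
qed

text \<open>Existence for the \<open>LEAST\<close> in \<open>log_star\<close>.\<close>

lemma ex_iterated_log_le: "v \<le> real (tower (Suc n)) \<Longrightarrow> \<exists>m. (log 2 ^^ m) v \<le> 1"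
proof (induction n arbitrary: v)
  case 0
  then show ?case by (intro exI[of _ 0]) simp
next
  case (Suc n)
  show ?case
  proof (cases "v \<le> 1")
    case True
    then show ?thesis by (intro exI[of _ 0]) simp
  next
    case False
    then have "log 2 v \<le> real (tower (Suc n))"
      using Suc.prems by (simp add: log_le_iff powr_tower del: tower.simps)
    then obtain m where "(log 2 ^^ m) (log 2 v) \<le> 1" using Suc.IH by blast
    then show ?thesis by (intro exI[of _ "Suc m"]) (simp add: funpow_swap1)
  qed
qed

lemma self_le_tower: "n \<le> tower (Suc n)"
proof (induction n)
  case (Suc n)
  have "n < 2 ^ n" by (rule less_exp)
  also have "(2 :: nat) ^ n \<le> 2 ^ tower (Suc n)" using Suc by (intro power_increasing) auto
  finally show ?case by simp
qed simp

lemma le_tower_log_star: "k \<le> tower (Suc (log_star k))"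
proof -
  have "\<exists>m. (log 2 ^^ m) (real k) \<le> 1"
    using self_le_tower by (intro ex_iterated_log_le[of _ k]) (metis of_nat_le_iff)
  then have "(log 2 ^^ log_star k) (real k) \<le> 1"
    unfolding log_star_def by (rule LeastI_ex)
  moreover have "1 < (log 2 ^^ j) (real k)" if "j < log_star k" for j
    using not_less_Least[OF that[unfolded log_star_def]] by simp
  ultimately show ?thesis using le_tower by (metis of_nat_le_iff)
qed


lemma tower_mono: "m \<le> n \<Longrightarrow> tower m \<le> tower n"
  by (rule lift_Suc_mono_le[of tower]) (auto intro: less_imp_le)

text \<open>A multiple of \<open>log_star k\<close> as the number of levels gives no level at all
  when \<open>log_star k = 0\<close>, where the factor \<open>2 powr (C * log_star k)\<close> is 1
  and could absorb no constant.\<close>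

lemma pred_le_tower_log_star: "k - 1 \<le> tower (2 * log_star k)"
proof (cases "log_star k = 0")
  case True
  then show ?thesis using le_tower_log_star[of k] by simp
next
  case False
  then have "tower (Suc (log_star k)) \<le> tower (2 * log_star k)" by (intro tower_mono) auto
  then show ?thesis using le_tower_log_star[of k] by linarith
qed

lemma depth_bound:
  fixes \<epsilon> \<delta> :: real
  assumes "1 \<le> n" "0 < \<epsilon>" "0 < \<delta>" "\<delta> \<le> 1 / 2"
    and q: "q = nat \<lceil>ln (4 * real n / \<delta>) * (2 * real n / \<epsilon>)\<rceil>"
  shows "real (depth (q + 2) n) \<le> 2 ^ (7 + 3 * n) * max 1 (1 / \<epsilon> * ln (1 / \<delta>))"
proof -
  define X where "X = max 1 (1 / \<epsilon> * ln (1 / \<delta>))"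
  have n1: "1 \<le> real n" "real n \<le> (real n)\<^sup>2" using assms(1) by (auto simp: power2_eq_square)
  have X: "1 \<le> X" "ln (1 / \<delta>) / \<epsilon> \<le> X" by (auto simp: X_def)
  \<comment> \<open>As \<delta> is at most 1/2, the term \<open>ln (4 * real n)\<close> is bounded
    by \<open>8 * real n * ln (1 / \<delta>)\<close>.\<close>
  have l: "1 / 2 \<le> ln (1 / \<delta>)"
  proof -
    have "1 / 2 \<le> ln (2 :: real)" using ln_le_minus_one[of "1 / 2 :: real"] by (simp add: ln_div)
    also have "\<dots> \<le> ln (1 / \<delta>)" using assms(3,4) by (simp add: field_simps)
    finally show ?thesis .
  qed
  have "ln (4 * real n / \<delta>) = ln (4 * real n) + ln (1 / \<delta>)"
    using assms(1,3) by (simp add: ln_div ln_mult)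
  moreover have "ln (4 * real n) \<le> 4 * real n * 1"
    using ln_le_minus_one[of "4 * real n"] n1 by simp
  moreover have "4 * real n * 1 \<le> 4 * real n * (2 * ln (1 / \<delta>))"
    using l by (intro mult_left_mono) auto
  moreover have "1 * ln (1 / \<delta>) \<le> real n * ln (1 / \<delta>)"
    using l n1 by (intro mult_right_mono) auto
  ultimately have a: "ln (4 * real n / \<delta>) \<le> 9 * real n * ln (1 / \<delta>)" by simp
  have "0 \<le> ln (4 * real n / \<delta>)"
    using assms n1 by (intro ln_ge_zero) (simp add: field_simps)
  then have "real q \<le> ln (4 * real n / \<delta>) * (2 * real n / \<epsilon>) + 1"
    unfolding q using assms(2) by simp
  also have "\<dots> \<le> 9 * real n * ln (1 / \<delta>) * (2 * real n / \<epsilon>) + 1"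
    using a assms(2) by (intro add_right_mono mult_right_mono) auto
  also have "\<dots> = 18 * (real n)\<^sup>2 * (ln (1 / \<delta>) / \<epsilon>) + 1"
    by (simp add: power2_eq_square)
  also have "\<dots> \<le> 18 * (real n)\<^sup>2 * X + 1"
    using X by (intro add_right_mono mult_left_mono) auto
  finally have "real (q + 2) \<le> 18 * (real n)\<^sup>2 * X + 3 * 1" by simp
  moreover have "1 * 1 \<le> (real n)\<^sup>2 * X" using X n1 by (intro mult_mono) auto
  ultimately have q2: "real (q + 2) \<le> 21 * ((real n)\<^sup>2 * X)" by linarith
  have "real (depth (q + 2) n) \<le> real (4 * (q + 2) * 2 ^ n)"
    using depth_eq[of "q + 2" n] by (simp only: of_nat_le_iff)
  also have "\<dots> = 4 * 2 ^ n * real (q + 2)" by simp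
  also have "\<dots> \<le> 4 * 2 ^ n * (21 * ((real n)\<^sup>2 * X))" using q2 by (intro mult_left_mono) auto
  also have "\<dots> = 84 * 2 ^ n * (real n)\<^sup>2 * X" by simp
  \<comment> \<open>Here 84 is rounded up to \<open>2 ^ 7\<close>, and the factor \<open>n\<close>
    squared, due to sharing the privacy budget among the levels, is absorbed by
    \<open>n < 2 ^ n\<close>.\<close>
  also have "\<dots> \<le> 128 * 2 ^ n * (2 ^ n)\<^sup>2 * X"
    using X of_nat_less_two_power[of n, where ?'a = real]
    by (intro mult_right_mono mult_mono power_mono) auto
  also have "\<dots> = 2 ^ (7 + 3 * n) * X"
    by (simp add: power_add power_mult power2_eq_square power3_eq_cube flip: power_mult_distrib)
  finally show ?thesis unfolding X_def .
qed

lemma approx_wrapper_exists: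
  fixes U :: "'a set" and Y :: "real set"
  assumes Y: "finite Y" "Y \<noteq> {}" and \<epsilon>: "0 < \<epsilon>" and \<delta>: "0 < \<delta>" "\<delta> < 1"
  shows "\<exists>l (W :: 'a wrapper). privacy_wrapper U \<epsilon> \<delta> W \<and> down_local U l W \<and>
    (\<forall>f. (\<forall>z\<in>Fpow U. f z \<in> Y) \<longrightarrow>
      (\<forall>x\<in>Fpow U.
        measure (wrapper_output W f x) (Some ` {Min (f ` DN l x)..Max (f ` DN l x)}) \<ge> 1)) \<and>
    real l \<le> 2 powr (18 * real (log_star (card Y))) * max 1 (1 / \<epsilon> * ln (1 / \<delta>))"
proof -
  define V n where "V = card Y - 1" and "n = 2 * log_star (card Y)"
  txt \<open>
    For \<open>\<delta> \<ge> 1/2\<close> the parameter \<open>ln (1/\<delta>)/\<epsilon>\<close> may be small even though \<open>\<epsilon>\<close> is; there a constant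
    privacy guarantee already implies \<open>(0, 1/2)\<close>-privacy.
  \<close>
  define \<epsilon>' \<delta>' :: real where "\<epsilon>' = (if \<delta> < 1 / 2 then \<epsilon> else 1 / 4)" and "\<delta>' = (if \<delta> < 1 / 2 then \<delta> else 1 / 8)"
  have \<epsilon>\<delta>': "0 < \<epsilon>'" "0 < \<delta>'" "\<delta>' \<le> 1 / 2" using \<epsilon> \<delta> by (auto simp: \<epsilon>'_def \<delta>'_def)
  \<comment> \<open>Each of the \<open>n\<close> levels costs \<open>2 * \<epsilon>0\<close>; for
    \<open>n = 0\<close> the value is 0 and no level is run.\<close>
  define \<epsilon>0 where "\<epsilon>0 = \<epsilon>' / (2 * real n)"
  \<comment> \<open>Large enough that \<open>exp \<epsilon>0 ^ q\<close> is at least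
    \<open>4 * n / \<delta>'\<close>, so that the additive errors of all levels sum to at most
    \<open>\<delta>'\<close>.\<close>
  define q where "q = nat \<lceil>ln (4 * real n / \<delta>') * (2 * real n / \<epsilon>')\<rceil>"
  define D where "D = depth (q + 2) n"
  have V: "V \<le> tower n" unfolding V_def n_def by (rule pred_le_tower_log_star)
  have \<epsilon>0: "real n * (2 * \<epsilon>0) \<le> \<epsilon>'" using \<epsilon>\<delta>' by (cases "n = 0") (auto simp: \<epsilon>0_def)
  have \<delta>0: "real n * (4 / exp \<epsilon>0 ^ q) \<le> \<delta>'"
  proof (cases "n = 0")
    case True
    then show ?thesis using \<epsilon>\<delta>' by simp
  next
    case False
    have "ln (4 * real n / \<delta>') * (2 * real n / \<epsilon>') \<le> real q" unfolding q_def by linarith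
    then have "ln (4 * real n / \<delta>') \<le> real q * \<epsilon>0"
      using False \<epsilon>\<delta>' by (simp add: \<epsilon>0_def field_simps)
    then have "exp (ln (4 * real n / \<delta>')) \<le> exp (real q * \<epsilon>0)" by simp
    then have "4 * real n / \<delta>' \<le> exp (real q * \<epsilon>0)"
      using False \<epsilon>\<delta>' by simp
    then have "4 * real n / \<delta>' \<le> exp \<epsilon>0 ^ q" by (simp only: exp_of_nat_mult)
    then show ?thesis using \<epsilon>\<delta>' by (simp add: field_simps)
  qed
  have pm: "pmass {..V} (mech \<epsilon>0 (q + 2) n V H)" if "seq V D H" for H
    using mech_correct[OF V that[unfolded D_def]] by simp
  have cl: "close \<epsilon> \<delta> {..V} (mech \<epsilon>0 (q + 2) n V H) (mech \<epsilon>0 (q + 2) n V H')"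
    if "seq V D H" "seq V D H'" "adj D H H'" for H H'
  proof -
    have Q: "\<forall>p\<in>{..V}. 0 \<le> mech \<epsilon>0 (q + 2) n V H' p" using pm[OF that(2)] by (simp add: pmass_def)
    have *: "close \<epsilon>' \<delta>' {..V} (mech \<epsilon>0 (q + 2) n V H) (mech \<epsilon>0 (q + 2) n V H')"
      using close_mono[OF mech_close[OF V that[unfolded D_def] refl] \<epsilon>0 \<delta>0 Q] .
    show ?thesis
    proof (cases "\<delta> < 1 / 2")
      case True
      then show ?thesis using * by (simp add: \<epsilon>'_def \<delta>'_def)
    next
      case False
      \<comment> \<open>Hence \<open>exp (1 / 4) - 1 + 1 / 8\<close> is at most 7/16, below
        1/2.\<close>
      have "exp (1 / 4) \<le> 1 + 1 / 4 + (1 / 4 :: real)\<^sup>2" by (rule exp_bound) auto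
      then have "exp \<epsilon>' - 1 + \<delta>' \<le> \<delta>" using False by (simp add: \<epsilon>'_def \<delta>'_def power2_eq_square)
      from close_mono[OF close_absorb[OF * pm[OF that(2)]] _ this Q] show ?thesis
        using \<epsilon> \<epsilon>\<delta>' by simp
    qed
  qed
  have ut: "1 - 0 \<le> sum (mech \<epsilon>0 (q + 2) n V H) {H D..H 0}" if "seq V D H" for H
  proof -
    have m: "pmass {..V} (mech \<epsilon>0 (q + 2) n V H)"
      "\<forall>p\<le>V. mech \<epsilon>0 (q + 2) n V H p \<noteq> 0 \<longrightarrow> H D \<le> p \<and> p \<le> H 0"
      using mech_correct[OF V that[unfolded D_def]] by (auto simp: D_def)
    have "H 0 \<le> V" using that by (simp add: seq_def)
    then have "sum (mech \<epsilon>0 (q + 2) n V H) {H D..H 0} = sum (mech \<epsilon>0 (q + 2) n V H) {..V}"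
      using m(2) by (intro sum.mono_neutral_left) auto
    then show ?thesis using m(1) by (simp add: pmass_def)
  qed
  have "real D \<le> 2 powr (18 * real (log_star (card Y))) * max 1 (1 / \<epsilon> * ln (1 / \<delta>))"
  proof (cases "n = 0")
    case True
    then show ?thesis by (simp add: D_def)
  next
    case False
    \<comment> \<open>The replaced parameters give \<open>4 * ln 8\<close>, at most 28.\<close>
    have "1 / \<epsilon>' * ln (1 / \<delta>') \<le> 2 ^ 5 * max 1 (1 / \<epsilon> * ln (1 / \<delta>))"
    proof (cases "\<delta> < 1 / 2")
      case True
      then show ?thesis by (simp add: \<epsilon>'_def \<delta>'_def)
    next
      case False
      then have "1 / \<epsilon>' * ln (1 / \<delta>') \<le> 2 ^ 5 * 1"
        using ln_le_minus_one[of "8 :: real"] by (simp add: \<epsilon>'_def \<delta>'_def)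
      also have "\<dots> \<le> 2 ^ 5 * max 1 (1 / \<epsilon> * ln (1 / \<delta>))" by (intro mult_left_mono) auto
      finally show ?thesis .
    qed
    then have X: "max 1 (1 / \<epsilon>' * ln (1 / \<delta>')) \<le> 2 ^ 5 * max 1 (1 / \<epsilon> * ln (1 / \<delta>))" by simp
    have "real D \<le> 2 ^ (7 + 3 * n) * max 1 (1 / \<epsilon>' * ln (1 / \<delta>'))"
      unfolding D_def using False \<epsilon>\<delta>' by (intro depth_bound) (auto simp: q_def)
    also have "\<dots> \<le> 2 ^ (7 + 3 * n) * (2 ^ 5 * max 1 (1 / \<epsilon> * ln (1 / \<delta>)))"
      using X by (intro mult_left_mono) auto
    also have "\<dots> = 2 ^ (12 + 3 * n) * max 1 (1 / \<epsilon> * ln (1 / \<delta>))"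
      by (simp add: power_add)
    \<comment> \<open>With \<open>n\<close> twice a positive \<open>log_star\<close>,
      \<open>12 + 3 * n\<close> is at most 18 times it.\<close>
    also have "\<dots> \<le> 2 ^ (18 * log_star (card Y)) * max 1 (1 / \<epsilon> * ln (1 / \<delta>))"
      using False by (intro mult_right_mono power_increasing) (auto simp: n_def)
    also have "(2 :: real) ^ (18 * log_star (card Y)) = 2 powr (18 * real (log_star (card Y)))"
      using powr_realpow[of 2 "18 * log_star (card Y)"] by simp
    finally show ?thesis .
  qed
  then show ?thesis 
    using wrapper_exists[where D = D and M = "mech \<epsilon>0 (q + 2) n V" and U = U, OF Y V_def pm cl ut]
    unfolding diff_zero by blast
qed

theorem theorem3p1:
  "\<exists>C1 > 0. \<exists>C2 > 0.
     \<forall>(U :: 'a set) (\<epsilon> :: real) (\<delta> :: real) (\<beta> :: real) (Y :: real set) (k :: nat).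
       countable U \<longrightarrow> \<epsilon> > 0 \<longrightarrow> \<delta> \<in> {0..<1} \<longrightarrow> \<beta> \<in> {0..<1} \<longrightarrow> finite Y \<longrightarrow> k = card Y \<longrightarrow>
       (\<beta> > 0 \<and> \<delta> = 0 \<or> \<delta> > 0 \<and> \<beta> = 0) \<longrightarrow>
       (\<exists>(l :: nat) (W :: 'a wrapper).
          privacy_wrapper U \<epsilon> \<delta> W \<and>
          down_local U l W \<and>
          (\<forall>f. (\<forall>z\<in>Fpow U. f z \<in> Y) \<longrightarrow>
             (\<forall>x\<in>Fpow U.
                measure (wrapper_output W f x) (Some ` {Min (f ` DN l x)..Max (f ` DN l x)})
                  \<ge> 1 - \<beta>)) \<and>
          (\<beta> > 0 \<longrightarrow> real l \<le> C1 * (1 / \<epsilon> * ln (real k / \<beta>))) \<and>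
          (\<delta> > 0 \<longrightarrow> real l \<le> 2 powr (C2 * real (log_star k)) * max 1 (1 / \<epsilon> * ln (1 / \<delta>))))"
proof (rule exI[of _ 4], rule conjI, simp, rule exI[of _ 18], rule conjI, simp, intro allI impI)
  fix U :: "'a set" and \<epsilon> \<delta> \<beta> :: real and Y :: "real set" and k :: nat
  assume \<epsilon>: "\<epsilon> > 0" and \<delta>: "\<delta> \<in> {0..<1}" and \<beta>: "\<beta> \<in> {0..<1}" and Y: "finite Y" and k: "k = card Y"
    and cases: "\<beta> > 0 \<and> \<delta> = 0 \<or> \<delta> > 0 \<and> \<beta> = 0"
  show "\<exists>(l :: nat) (W :: 'a wrapper).
          privacy_wrapper U \<epsilon> \<delta> W \<and>
          down_local U l W \<and>
          (\<forall>f. (\<forall>z\<in>Fpow U. f z \<in> Y) \<longrightarrow>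
             (\<forall>x\<in>Fpow U.
                measure (wrapper_output W f x) (Some ` {Min (f ` DN l x)..Max (f ` DN l x)})
                  \<ge> 1 - \<beta>)) \<and>
          (\<beta> > 0 \<longrightarrow> real l \<le> 4 * (1 / \<epsilon> * ln (real k / \<beta>))) \<and>
          (\<delta> > 0 \<longrightarrow> real l \<le> 2 powr (18 * real (log_star k)) * max 1 (1 / \<epsilon> * ln (1 / \<delta>)))"
  proof (cases "Y = {}")
    case True
    \<comment> \<open>No function maps into the empty range, since \<open>{}\<close> is a dataset,
      so only a private wrapper with \<open>l = 0\<close> is wanted. The one for the range
      \<open>{0}\<close> serves, and the first bound reads \<open>0 \<le> 0\<close> because
      \<open>ln 0 = 0\<close>.\<close>
    define P where "P H p = (1 :: real)" for H :: "nat \<Rightarrow> nat" and p :: nat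
    have "\<And>H. pmass {..0} (P H)" "\<And>H. 1 - 1 \<le> sum (P H) {H 0..H 0}"
      by (simp_all add: pmass_def P_def)
    moreover have "close \<epsilon> \<delta> {..0} (P H) (P H')" for H H'
      unfolding close_def P_def using \<epsilon> \<delta> by (intro exI[of _ "\<lambda>_. 0"]) auto
    ultimately have "\<exists>W :: 'a wrapper. privacy_wrapper U \<epsilon> \<delta> W \<and> down_local U 0 W"
      using wrapper_exists[of "{0}" 0 0 P \<epsilon> \<delta> 1 U] by auto
    moreover have "\<not> (\<forall>z\<in>Fpow U. f z \<in> Y)" for f :: "'a set \<Rightarrow> real"
      using True empty_in_Fpow by blast
    ultimately show ?thesis using True k by (intro exI[of _ 0]) auto
  next
    case False
    from cases show ?thesis
    proof
      assume "\<beta> > 0 \<and> \<delta> = 0"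
      then show ?thesis
        using pure_wrapper_exists[OF Y False \<epsilon>, of \<beta> U] \<beta> unfolding k by simp
    next
      assume "\<delta> > 0 \<and> \<beta> = 0"
      then show ?thesis
        using approx_wrapper_exists[OF Y False \<epsilon>, of \<delta> U] \<delta> unfolding k by simp
    qed
  qed
qed

end
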